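(* Let $1\le p<\infty$ and let $(X,\mathcal B,\mu,f,T_f)$ be a dissipative composition dynamical system of bounded distortion generated by $W$, with $T_f:L^p(X)\to L^p(X)$, $T_f(\varphi)=\varphi\circ f$. Let $B_w:\ell^p(\mathbb Z)\to\ell^p(\mathbb Z)$ be the bilateral weighted backward shift with weights \[ w_k=\left(\frac{\mu(f^{k-1}(W))}{\mu(f^{k}(W))}\right)^{\frac1p},\qquad k\in\mathbb Z. \] Then $T_f$ is $\mathbb R$-supercyclic if and only if $B_w$ is $\mathbb R$-supercyclic.
   Context: Setting: $X$ is a locally compact, $\sigma$-compact, second countable Hausdorff space, $\mathcal B$ is the Borel $\sigma$-algebra of $X$, and $\mu$ is a locally finite Borel measure on $X$ (hence $\sigma$-finite). The map $f:X\to X$ is bijective and bimeasurable (both $f$ and $f^{-1}$ are measurable), and the Radon-Nikodym derivatives of $\mu\circ f$ and of $\mu\circ f^{-1}$ with respect to $\mu$ exist and are bounded from below (by a positive constant). Then $T_f(\varphi)=\varphi\circ f$ is a well-defined bounded invertible linear operator on the space $L^p(X)=L^p(X,\mathcal B,\mu)$ of complex-valued functions, called a composition operator, and $(X,\mathcal B,\mu,f,T_f)$ is called a composition dynamical system. The system is dissipative, generated by $W$, if $W\in\mathcal B$, $0<\mu(W)<\infty$, and $X=\bigcup_{k\in\mathbb Z}f^k(W)$ with the sets $f^k(W)$, $k\in\mathbb Z$, pairwise disjoint. It is of bounded distortion if, in addition, there is $K>0$ such that \[ \frac1K\,\mu(f^k(W))\,\mu(B)\le \mu(f^k(B))\,\mu(W)\le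 K\,\mu(f^k(W))\,\mu(B) \] for all $k\in\mathbb Z$ and all measurable $B\subseteq W$ with $\mu(B)>0$. Given a bounded sequence $\{w_i\}_{i\in\mathbb Z}$, the bilateral weighted backward shift $B_w$ on the complex space $\ell^p(\mathbb Z)$ is defined by $(B_w x)(i)=w_{i+1}x_{i+1}$, $i\in\mathbb Z$. A bounded linear operator $T$ on a separable Banach space $E$ is $\mathbb R$-supercyclic if there is $x\in E$ such that $\{\lambda T^n x: n\ge 0,\ \lambda\in\mathbb R\}$ is dense in $E$. *)

theory Defs
  imports "HOL-Analysis.Analysis"
begin

subsection \<open>Real supercyclicity\<close>

text \<open>
  The spaces \<open>L\<^sup>p(\<mu>)\<close> depend on a measure and are not types, so the Banach space is given by
  its carrier \<open>E\<close>, the distance \<open>d\<close> induced by its norm, and multiplication \<open>scl\<close>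
  by real scalars.
\<close>

definition real_supercyclic ::
    "'v set \<Rightarrow> ('v \<Rightarrow> 'v \<Rightarrow> real) \<Rightarrow> (real \<Rightarrow> 'v \<Rightarrow> 'v) \<Rightarrow> ('v \<Rightarrow> 'v) \<Rightarrow> bool" where
  "real_supercyclic E d scl T \<longleftrightarrow>
    (\<exists>x\<in>E. \<forall>y\<in>E. \<forall>e>0. \<exists>z\<in>{scl l ((T ^^ n) x) | l n. True}. d z y < e)"


subsection \<open>Complex \<open>L\<^sup>p\<close> spaces, modulo equality almost everywhere\<close>

definition Lp_funs :: "'a measure \<Rightarrow> real \<Rightarrow> ('a \<Rightarrow> complex) set" where
  "Lp_funs M p = {\<phi> \<in> borel_measurable M. integrable M (\<lambda>x. norm (\<phi> x) powr p)}"

definition Lp_norm :: "'a measure \<Rightarrow> real \<Rightarrow> ('a \<Rightarrow> complex) \<Rightarrow> real" where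
  "Lp_norm M p \<phi> = (\<integral>x. norm (\<phi> x) powr p \<partial>M) powr (1 / p)"

definition Lp_eq :: "'a measure \<Rightarrow> real \<Rightarrow> (('a \<Rightarrow> complex) \<times> ('a \<Rightarrow> complex)) set" where
  "Lp_eq M p = {(\<phi>, \<psi>). \<phi> \<in> Lp_funs M p \<and> \<psi> \<in> Lp_funs M p \<and> (AE x in M. \<phi> x = \<psi> x)}"

definition Lp_space :: "'a measure \<Rightarrow> real \<Rightarrow> ('a \<Rightarrow> complex) set set" where
  "Lp_space M p = Lp_funs M p // Lp_eq M p"

definition Lp_dist ::
    "'a measure \<Rightarrow> real \<Rightarrow> ('a \<Rightarrow> complex) set \<Rightarrow> ('a \<Rightarrow> complex) set \<Rightarrow> real" where
  "Lp_dist M p C D = the_elem (\<Union>\<phi>\<in>C. \<Union>\<psi>\<in>D. {Lp_norm M p (\<lambda>x. \<phi> x - \<psi> x)})"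

definition Lp_scale ::
    "'a measure \<Rightarrow> real \<Rightarrow> real \<Rightarrow> ('a \<Rightarrow> complex) set \<Rightarrow> ('a \<Rightarrow> complex) set" where
  "Lp_scale M p l C = (\<Union>\<phi>\<in>C. Lp_eq M p `` {\<lambda>x. of_real l * \<phi> x})"

definition composition_operator ::
    "'a measure \<Rightarrow> real \<Rightarrow> ('a \<Rightarrow> 'a) \<Rightarrow> ('a \<Rightarrow> complex) set \<Rightarrow> ('a \<Rightarrow> complex) set" where
  "composition_operator M p f C = (\<Union>\<phi>\<in>C. Lp_eq M p `` {\<phi> \<circ> f})"


subsection \<open>Composition dynamical systems\<close>

text \<open>
  In \<open>RN_deriv_bounded_below M N\<close>, the equation says that the derivative of \<open>N\<close> with respect
  to \<open>M\<close> exists, since \<^const>\<open>RN_deriv\<close> is \<open>0\<close> by convention otherwise.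
\<close>

definition RN_deriv_bounded_below :: "'a measure \<Rightarrow> 'a measure \<Rightarrow> bool" where
  "RN_deriv_bounded_below M N \<longleftrightarrow>
    density M (RN_deriv M N) = N \<and> (\<exists>c::real. c > 0 \<and> (AE x in M. ennreal c \<le> RN_deriv M N x))"

text \<open>
  As \<open>f\<close> is a bijection, \<open>distr M M (inv f)\<close> is the measure \<open>\<mu> \<circ> f\<close>, that is
  \<open>B \<mapsto> \<mu>(f(B))\<close>, and \<open>distr M M f\<close> is \<open>\<mu> \<circ> f\<^sup>-\<^sup>1\<close>.
\<close>

locale composition_dynamical_system =
  fixes M :: "'a::{second_countable_topology, t2_space} measure"
    and f :: "'a \<Rightarrow> 'a"
  assumes locally_compact: "locally_compact_space (euclidean :: 'a topology)"
    and sigma_compact: "\<exists>K :: nat \<Rightarrow> 'a set. (\<forall>n. compact (K n)) \<and> (\<Union>n. K n) = UNIV"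
    and sets_eq_borel: "sets M = sets borel"
    and locally_finite: "\<forall>x. \<exists>U. open U \<and> x \<in> U \<and> emeasure M U < \<infinity>"
    and bij: "bij f"
    and measurable_f: "f \<in> measurable M M"
    and measurable_inv_f: "inv f \<in> measurable M M"
    and RN_image: "RN_deriv_bounded_below M (distr M M (inv f))"
    and RN_preimage: "RN_deriv_bounded_below M (distr M M f)"

definition int_iterate :: "('a \<Rightarrow> 'a) \<Rightarrow> int \<Rightarrow> 'a \<Rightarrow> 'a" where
  "int_iterate f k = (if 0 \<le> k then f ^^ nat k else inv f ^^ nat (- k))"

locale dissipative_system = composition_dynamical_system M f
  for M :: "'a::{second_countable_topology, t2_space} measure" and f +
  fixes W :: "'a set"
  assumes W_sets: "W \<in> sets M"
    and W_pos: "0 < emeasure M W"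
    and W_finite: "emeasure M W < \<infinity>"
    and W_cover: "(\<Union>k. int_iterate f k ` W) = UNIV"
    and W_disjoint: "disjoint_family (\<lambda>k. int_iterate f k ` W)"

locale bounded_distortion_system = dissipative_system M f W
  for M :: "'a::{second_countable_topology, t2_space} measure" and f and W +
  assumes bounded_distortion:
    "\<exists>K::real. K > 0 \<and> (\<forall>k. \<forall>B\<in>sets M. B \<subseteq> W \<longrightarrow> emeasure M B > 0 \<longrightarrow>
      ennreal (1 / K) * emeasure M (int_iterate f k ` W) * emeasure M B
        \<le> emeasure M (int_iterate f k ` B) * emeasure M W \<and>
      emeasure M (int_iterate f k ` B) * emeasure M W
        \<le> ennreal K * emeasure M (int_iterate f k ` W) * emeasure M B)"


subsection \<open>Weighted shifts on \<open>\<ell>\<^sup>p(\<int>)\<close>\<close>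

definition lp_space :: "real \<Rightarrow> (int \<Rightarrow> complex) set" where
  "lp_space p = {x. (\<lambda>i. norm (x i) powr p) summable_on UNIV}"

definition lp_dist :: "real \<Rightarrow> (int \<Rightarrow> complex) \<Rightarrow> (int \<Rightarrow> complex) \<Rightarrow> real" where
  "lp_dist p x y = (\<Sum>\<^sub>\<infinity>i. norm (x i - y i) powr p) powr (1 / p)"

definition lp_scale :: "real \<Rightarrow> (int \<Rightarrow> complex) \<Rightarrow> int \<Rightarrow> complex" where
  "lp_scale l x = (\<lambda>i. of_real l * x i)"

definition backward_shift :: "(int \<Rightarrow> real) \<Rightarrow> (int \<Rightarrow> complex) \<Rightarrow> int \<Rightarrow> complex" where
  "backward_shift w x = (\<lambda>i. of_real (w (i + 1)) * x (i + 1))"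

definition system_weights :: "'a measure \<Rightarrow> ('a \<Rightarrow> 'a) \<Rightarrow> 'a set \<Rightarrow> real \<Rightarrow> int \<Rightarrow> real" where
  "system_weights M f W p k =
    (measure M (int_iterate f (k - 1) ` W) / measure M (int_iterate f k ` W)) powr (1 / p)"


subsection \<open>The operations on classes do not depend on representatives\<close>

lemma Lp_eq_equiv: "equiv (Lp_funs M p) (Lp_eq M p)"
proof (rule equivI)
  show "Lp_eq M p \<subseteq> Lp_funs M p \<times> Lp_funs M p" by (auto simp: Lp_eq_def)
  show "refl_on (Lp_funs M p) (Lp_eq M p)" by (auto simp: Lp_eq_def refl_on_def)
  show "sym (Lp_eq M p)" by (auto simp: Lp_eq_def sym_def elim: AE_mp)
  show "trans (Lp_eq M p)"
  proof (rule transI)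
    fix a b c assume "(a, b) \<in> Lp_eq M p" "(b, c) \<in> Lp_eq M p"
    then show "(a, c) \<in> Lp_eq M p" unfolding Lp_eq_def by force
  qed
qed

lemma Lp_dist_class:
  assumes "\<phi> \<in> Lp_funs M p" "\<psi> \<in> Lp_funs M p"
  shows "Lp_dist M p (Lp_eq M p `` {\<phi>}) (Lp_eq M p `` {\<psi>}) = Lp_norm M p (\<lambda>x. \<phi> x - \<psi> x)"
proof -
  have eq: "Lp_norm M p (\<lambda>x. a x - b x) = Lp_norm M p (\<lambda>x. \<phi> x - \<psi> x)"
    if "(\<phi>, a) \<in> Lp_eq M p" "(\<psi>, b) \<in> Lp_eq M p" for a b
  proof -
    have [measurable]: "a \<in> borel_measurable M" "b \<in> borel_measurable M"
      "\<phi> \<in> borel_measurable M" "\<psi> \<in> borel_measurable M"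
      and ae: "AE x in M. \<phi> x = a x" "AE x in M. \<psi> x = b x"
      using that by (auto simp: Lp_eq_def Lp_funs_def)
    have "(\<integral>x. norm (a x - b x) powr p \<partial>M) = (\<integral>x. norm (\<phi> x - \<psi> x) powr p \<partial>M)"
      by (rule integral_cong_AE) (use ae in auto)
    then show ?thesis by (simp add: Lp_norm_def)
  qed
  have "\<phi> \<in> Lp_eq M p `` {\<phi>}" "\<psi> \<in> Lp_eq M p `` {\<psi>}"
    using assms by (auto simp: Lp_eq_def)
  then have "(\<Union>a\<in>Lp_eq M p `` {\<phi>}. \<Union>b\<in>Lp_eq M p `` {\<psi>}. {Lp_norm M p (\<lambda>x. a x - b x)})
      = {Lp_norm M p (\<lambda>x. \<phi> x - \<psi> x)}"
    using eq by blast
  then show ?thesis unfolding Lp_dist_def by simp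
qed

lemma Lp_scale_funs:
  assumes "\<phi> \<in> Lp_funs M p"
  shows "(\<lambda>x. of_real l * \<phi> x) \<in> Lp_funs M p"
  using assms by (auto simp: Lp_funs_def norm_mult powr_mult)

lemma Lp_scale_class:
  assumes "\<phi> \<in> Lp_funs M p"
  shows "Lp_scale M p l (Lp_eq M p `` {\<phi>}) = Lp_eq M p `` {\<lambda>x. of_real l * \<phi> x}"
  unfolding Lp_scale_def
proof (rule UN_equiv_class[OF Lp_eq_equiv _ assms], rule congruentI)
  fix a b assume "(a, b) \<in> Lp_eq M p"
  then have "(\<lambda>x. of_real l * a x, \<lambda>x. of_real l * b x) \<in> Lp_eq M p"
    by (auto simp: Lp_eq_def Lp_scale_funs elim: AE_mp)
  then show "Lp_eq M p `` {\<lambda>x. of_real l * a x} = Lp_eq M p `` {\<lambda>x. of_real l * b x}"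
    using equiv_class_eq[OF Lp_eq_equiv] by blast
qed

lemma (in composition_dynamical_system) emeasure_vimage_le:
  "\<exists>C::real. C > 0 \<and> (\<forall>A\<in>sets M. emeasure M (f -` A) \<le> ennreal C * emeasure M A)"
proof -
  have space: "space M = UNIV" using sets_eq_borel by (simp add: sets_eq_imp_space_eq)
  obtain c :: real where c: "c > 0" "AE x in M. ennreal c \<le> RN_deriv M (distr M M (inv f)) x"
    and d: "density M (RN_deriv M (distr M M (inv f))) = distr M M (inv f)"
    using RN_image by (auto simp: RN_deriv_bounded_below_def)
  have "emeasure M (f -` A) \<le> ennreal (1 / c) * emeasure M A" if A: "A \<in> sets M" for A
  proof -
    have fA: "f -` A \<in> sets M" using measurable_sets[OF measurable_f A] space by simp
    have "ennreal c * emeasure M (f -` A) = (\<integral>\<^sup>+x. ennreal c * indicator (f -` A) x \<partial>M)"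
      using fA by (simp add: nn_integral_cmult_indicator)
    also have "\<dots> \<le> (\<integral>\<^sup>+x. RN_deriv M (distr M M (inv f)) x * indicator (f -` A) x \<partial>M)"
      by (rule nn_integral_mono_AE) (use c(2) in \<open>auto elim!: AE_mp intro!: mult_right_mono\<close>)
    also have "\<dots> = emeasure (density M (RN_deriv M (distr M M (inv f)))) (f -` A)"
      using fA by (simp add: emeasure_density)
    also have "\<dots> = emeasure M (inv f -` (f -` A))"
      using fA space by (simp add: d emeasure_distr measurable_inv_f)
    also have "inv f -` (f -` A) = A"
      using bij by (auto simp: bij_is_surj surj_f_inv_f)
    finally have "ennreal (1 / c) * (ennreal c * emeasure M (f -` A)) \<le> ennreal (1 / c) * emeasure M A"
      by (intro mult_left_mono) auto
    then show ?thesis using c(1) by (simp add: mult.assoc[symmetric] ennreal_mult[symmetric])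
  qed
  then show ?thesis using c(1) by (intro exI[of _ "1 / c"]) auto
qed

lemma (in composition_dynamical_system) AE_comp:
  assumes "AE x in M. P x"
  shows "AE x in M. P (f x)"
proof -
  have space: "space M = UNIV" using sets_eq_borel by (simp add: sets_eq_imp_space_eq)
  obtain C :: real where C: "\<And>A. A \<in> sets M \<Longrightarrow> emeasure M (f -` A) \<le> ennreal C * emeasure M A"
    using emeasure_vimage_le by auto
  obtain N where N: "{x \<in> space M. \<not> P x} \<subseteq> N" "emeasure M N = 0" "N \<in> sets M"
    using assms by (auto elim: AE_E)
  have "emeasure M (f -` N) = 0" using C[OF N(3)] N(2) by simp
  moreover have "f -` N \<in> sets M" using measurable_sets[OF measurable_f N(3)] space by simp
  ultimately show ?thesis
    using N(1) space by (intro AE_I[of _ _ "f -` N"]) auto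
qed

lemma (in composition_dynamical_system) comp_Lp_funs:
  assumes "\<phi> \<in> Lp_funs M p"
  shows "\<phi> \<circ> f \<in> Lp_funs M p"
proof -
  have space: "space M = UNIV" using sets_eq_borel by (simp add: sets_eq_imp_space_eq)
  obtain C :: real where C: "\<And>A. A \<in> sets M \<Longrightarrow> emeasure M (f -` A) \<le> ennreal C * emeasure M A"
    using emeasure_vimage_le by auto
  note [measurable] = measurable_f
  have meas[measurable]: "\<phi> \<in> borel_measurable M" and int: "integrable M (\<lambda>x. norm (\<phi> x) powr p)"
    using assms by (auto simp: Lp_funs_def)
  have "(\<integral>\<^sup>+x. ennreal (norm (\<phi> (f x)) powr p) \<partial>M) = (\<integral>\<^sup>+x. ennreal (norm (\<phi> x) powr p) \<partial>distr M M f)"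
    by (subst nn_integral_distr) auto
  also have "\<dots> \<le> (\<integral>\<^sup>+x. ennreal (norm (\<phi> x) powr p) \<partial>scale_measure (ennreal C) M)"
  proof (rule nn_integral_mono_measure)
    show "distr M M f \<le> scale_measure (ennreal C) M"
    proof (subst le_measure)
      show "\<forall>A\<in>sets (distr M M f). emeasure (distr M M f) A \<le> emeasure (scale_measure (ennreal C) M) A"
        using C space by (auto simp: emeasure_distr)
    qed simp
  qed simp
  also have "\<dots> = ennreal C * (\<integral>\<^sup>+x. ennreal (norm (\<phi> x) powr p) \<partial>M)"
    by (simp add: nn_integral_scale_measure)
  also have "\<dots> < \<infinity>"
    using int by (auto simp: integrable_iff_bounded ennreal_mult_less_top)
  finally have "integrable M (\<lambda>x. norm (\<phi> (f x)) powr p)"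
    by (auto simp: integrable_iff_bounded)
  moreover have "\<phi> \<circ> f \<in> borel_measurable M" by measurable
  ultimately show ?thesis by (auto simp: Lp_funs_def)
qed

lemma (in composition_dynamical_system) composition_operator_class:
  assumes "\<phi> \<in> Lp_funs M p"
  shows "composition_operator M p f (Lp_eq M p `` {\<phi>}) = Lp_eq M p `` {\<phi> \<circ> f}"
  unfolding composition_operator_def
proof (rule UN_equiv_class[OF Lp_eq_equiv _ assms], rule congruentI)
  fix a b assume "(a, b) \<in> Lp_eq M p"
  then have "(a \<circ> f, b \<circ> f) \<in> Lp_eq M p"
    using AE_comp[of "\<lambda>x. a x = b x"] by (auto simp: Lp_eq_def comp_Lp_funs)
  then show "Lp_eq M p `` {a \<circ> f} = Lp_eq M p `` {b \<circ> f}"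
    using equiv_class_eq[OF Lp_eq_equiv] by blast
qed

end

theory Submission
  imports Defs
begin

text \<open>
  Write \<open>m k = \<mu>(f\<^sup>k(W))\<close>. The substitution \<open>x k = (m k)\<^bsup>1/p\<^esup> a k\<close> turns the weighted shift into
  the unweighted shift \<open>a k \<mapsto> a (k + 1)\<close> on \<open>\<ell>\<^sup>p(\<int>, m)\<close>, which is the restriction of the composition
  operator to the functions that are constant on every \<open>f\<^sup>k(W)\<close>. Averaging \<open>\<phi> \<circ> f\<^sup>k\<close> over \<open>W\<close> maps
  \<open>L\<^sup>p(X)\<close> back onto \<open>\<ell>\<^sup>p(\<int>, m)\<close> and intertwines the two operators; it is bounded by bounded
  distortion, so supercyclicity passes from the composition operator to the shift.

  Conversely, supercyclicity of the shift yields, for every \<open>Q\<close> and \<open>\<epsilon>\<close>, arbitrarily large \<open>n\<close> with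
  \<open>m (i - n) * m (j + n) < \<epsilon>\<close> for all \<open>\<bar>i\<bar>, \<bar>j\<bar> \<le> Q\<close>: compare two orbit elements
  close to \<open>\<Sum>\<^bsub>\<bar>i\<bar> \<le> Q\<^esub> e\<^sub>i\<close>. Let \<open>y\<^sub>k\<close> be a dense sequence of bounded functions, each
  supported on finitely many \<open>f\<^sup>i(W)\<close>. For suitable \<open>n\<^sub>k\<close> and \<open>c\<^sub>k > 0\<close>, the function
  \<open>\<phi> = \<Sum>\<^sub>j c\<^sub>j y\<^sub>j \<circ> f\<^bsup>-n\<^sub>j\<^esup>\<close> is a sum of functions with disjoint supports and
  \<open>c\<^sub>k\<^bsup>-1\<^esup> \<phi> \<circ> f\<^bsup>n\<^sub>k\<^esup> - y\<^sub>k\<close> tends to \<open>0\<close>, so \<open>\<phi>\<close> is a supercyclic vector.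
\<close>

subsection \<open>\<open>p\<close>-th powers of \<open>L\<^sup>p\<close> norms\<close>

lemma powr_norm_add_le:
  fixes a b :: "'b::real_normed_vector"
  assumes "0 \<le> p"
  shows "norm (a + b) powr p \<le> 2 powr p * (norm a powr p + norm b powr p)"
proof -
  have "norm (a + b) \<le> 2 * max (norm a) (norm b)"
    using norm_triangle_ineq[of a b] by linarith
  then have "norm (a + b) powr p \<le> (2 * max (norm a) (norm b)) powr p"
    using assms by (intro powr_mono2) auto
  also have "\<dots> = 2 powr p * max (norm a) (norm b) powr p"
    by (simp add: powr_mult)
  also have "\<dots> \<le> 2 powr p * (norm a powr p + norm b powr p)"
    by (intro mult_left_mono) (auto simp: max_def)
  finally show ?thesis .
qed

lemma powr_norm_diff_le:
  fixes a b :: "'b::real_normed_vector"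
  assumes "0 \<le> p"
  shows "norm (a - b) powr p \<le> 2 powr p * (norm a powr p + norm b powr p)"
  using powr_norm_add_le[OF assms, of a "- b"] by simp

definition Lp_pow :: "'a measure \<Rightarrow> real \<Rightarrow> ('a \<Rightarrow> complex) \<Rightarrow> real" where
  "Lp_pow M p \<phi> = (\<integral>x. norm (\<phi> x) powr p \<partial>M)"

lemma Lp_pow_nonneg: "0 \<le> Lp_pow M p \<phi>"
  by (simp add: Lp_pow_def)

lemma nn_integral_Lp_pow:
  assumes "\<phi> \<in> Lp_funs M p"
  shows "(\<integral>\<^sup>+x. ennreal (norm (\<phi> x) powr p) \<partial>M) = ennreal (Lp_pow M p \<phi>)"
  using assms unfolding Lp_pow_def Lp_funs_def by (intro nn_integral_eq_integral) auto

lemma Lp_funs_nn_integralI: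
  assumes "\<phi> \<in> borel_measurable M" "(\<integral>\<^sup>+x. ennreal (norm (\<phi> x) powr p) \<partial>M) \<le> ennreal r" "0 \<le> r"
  shows "\<phi> \<in> Lp_funs M p" "Lp_pow M p \<phi> \<le> r"
proof -
  note [measurable] = assms(1)
  show *: "\<phi> \<in> Lp_funs M p"
    using assms by (auto simp: Lp_funs_def integrable_iff_bounded intro: le_less_trans)
  show "Lp_pow M p \<phi> \<le> r"
    using assms(2,3) nn_integral_Lp_pow[OF *] by simp
qed

lemma Lp_funs_add:
  assumes "0 \<le> p" "\<phi> \<in> Lp_funs M p" "\<psi> \<in> Lp_funs M p"
  shows "(\<lambda>x. \<phi> x + \<psi> x) \<in> Lp_funs M p"
    and "Lp_pow M p (\<lambda>x. \<phi> x + \<psi> x) \<le> 2 powr p * (Lp_pow M p \<phi> + Lp_pow M p \<psi>)"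
proof -
  have [measurable]: "\<phi> \<in> borel_measurable M" "\<psi> \<in> borel_measurable M"
    and int: "integrable M (\<lambda>x. norm (\<phi> x) powr p)" "integrable M (\<lambda>x. norm (\<psi> x) powr p)"
    using assms by (auto simp: Lp_funs_def)
  have i: "integrable M (\<lambda>x. 2 powr p * (norm (\<phi> x) powr p + norm (\<psi> x) powr p))"
    using int by auto
  have j: "integrable M (\<lambda>x. norm (\<phi> x + \<psi> x) powr p)"
    by (rule Bochner_Integration.integrable_bound[OF i])
      (use powr_norm_add_le[OF assms(1)] in auto)
  then show "(\<lambda>x. \<phi> x + \<psi> x) \<in> Lp_funs M p" by (auto simp: Lp_funs_def)
  have "Lp_pow M p (\<lambda>x. \<phi> x + \<psi> x)
      \<le> (\<integral>x. 2 powr p * (norm (\<phi> x) powr p + norm (\<psi> x) powr p) \<partial>M)"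
    unfolding Lp_pow_def
    by (rule integral_mono[OF j i]) (use powr_norm_add_le[OF assms(1)] in auto)
  also have "\<dots> = 2 powr p * (Lp_pow M p \<phi> + Lp_pow M p \<psi>)"
    using int by (simp add: Lp_pow_def)
  finally show "Lp_pow M p (\<lambda>x. \<phi> x + \<psi> x) \<le> 2 powr p * (Lp_pow M p \<phi> + Lp_pow M p \<psi>)" .
qed

lemma Lp_funs_cmult:
  assumes "\<phi> \<in> Lp_funs M p"
  shows "(\<lambda>x. c * \<phi> x) \<in> Lp_funs M p"
  using assms by (auto simp: Lp_funs_def norm_mult powr_mult)

lemma Lp_pow_cmult: "Lp_pow M p (\<lambda>x. c * \<phi> x) = norm c powr p * Lp_pow M p \<phi>"
  by (simp add: Lp_pow_def norm_mult powr_mult)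

lemma Lp_funs_diff:
  assumes "0 \<le> p" "\<phi> \<in> Lp_funs M p" "\<psi> \<in> Lp_funs M p"
  shows "(\<lambda>x. \<phi> x - \<psi> x) \<in> Lp_funs M p"
    and "Lp_pow M p (\<lambda>x. \<phi> x - \<psi> x) \<le> 2 powr p * (Lp_pow M p \<phi> + Lp_pow M p \<psi>)"
proof -
  have m: "(\<lambda>x. - 1 * \<psi> x) \<in> Lp_funs M p" using assms(3) by (rule Lp_funs_cmult)
  show "(\<lambda>x. \<phi> x - \<psi> x) \<in> Lp_funs M p"
    using Lp_funs_add(1)[OF assms(1,2) m] by simp
  show "Lp_pow M p (\<lambda>x. \<phi> x - \<psi> x) \<le> 2 powr p * (Lp_pow M p \<phi> + Lp_pow M p \<psi>)"
    using Lp_funs_add(2)[OF assms(1,2) m] Lp_pow_cmult[of M p "-1" \<psi>] by simp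
qed

lemma Lp_pow_triangle:
  assumes "0 \<le> p" "\<phi> \<in> Lp_funs M p" "\<psi> \<in> Lp_funs M p" "\<theta> \<in> Lp_funs M p"
  shows "Lp_pow M p (\<lambda>x. \<phi> x - \<theta> x)
    \<le> 2 powr p * (Lp_pow M p (\<lambda>x. \<phi> x - \<psi> x) + Lp_pow M p (\<lambda>x. \<psi> x - \<theta> x))"
  using Lp_funs_add(2)[OF assms(1) Lp_funs_diff(1)[OF assms(1,2,3)] Lp_funs_diff(1)[OF assms(1,3,4)]]
  by simp

lemma Lp_pow_dominated_convergence:
  assumes "\<phi> \<in> Lp_funs M p" "\<And>n. s n \<in> borel_measurable M" "0 < p"
    "\<And>x. (\<lambda>n. s n x) \<longlonglongrightarrow> \<phi> x" "\<And>n x. norm (s n x) \<le> 2 * norm (\<phi> x)"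
  shows "(\<lambda>n. Lp_pow M p (\<lambda>x. \<phi> x - s n x)) \<longlonglongrightarrow> 0"
proof -
  note [measurable] = assms(2)
  have [measurable]: "\<phi> \<in> borel_measurable M"
    and int: "integrable M (\<lambda>x. norm (\<phi> x) powr p)"
    using assms by (auto simp: Lp_funs_def)
  have "(\<lambda>n. \<integral>x. norm (\<phi> x - s n x) powr p \<partial>M) \<longlonglongrightarrow> (\<integral>x. 0 \<partial>M)"
  proof (rule integral_dominated_convergence)
    show "integrable M (\<lambda>x. (3 * norm (\<phi> x)) powr p)"
      using int by (simp add: powr_mult)
    show "AE x in M. (\<lambda>n. norm (\<phi> x - s n x) powr p) \<longlonglongrightarrow> 0"
    proof (intro AE_I2)
      fix x
      have "(\<lambda>n. norm (\<phi> x - s n x)) \<longlonglongrightarrow> norm (\<phi> x - \<phi> x)"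
        by (intro tendsto_intros assms)
      then have "(\<lambda>n. norm (\<phi> x - s n x) powr p) \<longlonglongrightarrow> 0 powr p"
        using assms(3) by (intro tendsto_powr') auto
      then show "(\<lambda>n. norm (\<phi> x - s n x) powr p) \<longlonglongrightarrow> 0" by simp
    qed
    show "AE x in M. norm (norm (\<phi> x - s n x) powr p) \<le> (3 * norm (\<phi> x)) powr p" for n
    proof (intro AE_I2)
      fix x
      have "norm (\<phi> x - s n x) \<le> 3 * norm (\<phi> x)"
        using norm_triangle_ineq4[of "\<phi> x" "s n x"] assms(5)[where n=n and x=x] by linarith
      then show "norm (norm (\<phi> x - s n x) powr p) \<le> (3 * norm (\<phi> x)) powr p"
        using assms(3) by (auto intro!: powr_mono2)
    qed
  qed auto
  then show ?thesis by (simp add: Lp_pow_def)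
qed

lemma norm_powr_suminf_disjoint:
  fixes z :: "nat \<Rightarrow> complex"
  assumes "\<And>i j. z i \<noteq> 0 \<Longrightarrow> z j \<noteq> 0 \<Longrightarrow> i = j"
  shows "summable z"
    and "ennreal (norm (\<Sum>j. z j) powr p) = (\<Sum>j. ennreal (norm (z j) powr p))"
proof -
  obtain k where k: "\<And>j. j \<noteq> k \<Longrightarrow> z j = 0" using assms by blast
  show "summable z" by (rule summable_finite[of "{k}"]) (use k in auto)
  have "(\<Sum>j. z j) = (\<Sum>j\<in>{k}. z j)" by (rule suminf_finite) (use k in auto)
  then have "(\<Sum>j. z j) = z k" by simp
  moreover have "(\<Sum>j. ennreal (norm (z j) powr p)) = (\<Sum>j\<in>{k}. ennreal (norm (z j) powr p))"
    by (rule suminf_finite) (use k in auto)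
  ultimately show "ennreal (norm (\<Sum>j. z j) powr p) = (\<Sum>j. ennreal (norm (z j) powr p))" by simp
qed

lemma Lp_funs_suminf_disjoint:
  fixes z :: "nat \<Rightarrow> 'a \<Rightarrow> complex"
  assumes disj: "\<And>x i j. z i x \<noteq> 0 \<Longrightarrow> z j x \<noteq> 0 \<Longrightarrow> i = j"
    and z: "\<And>j. z j \<in> Lp_funs M p"
    and r: "summable r" "\<And>j. Lp_pow M p (z j) \<le> r j"
  shows "(\<lambda>x. \<Sum>j. z j x) \<in> Lp_funs M p"
    and "Lp_pow M p (\<lambda>x. \<Sum>j. z j x) \<le> (\<Sum>j. r j)"
proof -
  have [measurable]: "z j \<in> borel_measurable M" for j using z by (simp add: Lp_funs_def)
  have r0: "0 \<le> r j" for j using r(2)[of j] Lp_pow_nonneg[of M p "z j"] by linarith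
  have "(\<integral>\<^sup>+x. ennreal (norm (\<Sum>j. z j x) powr p) \<partial>M)
      = (\<integral>\<^sup>+x. (\<Sum>j. ennreal (norm (z j x) powr p)) \<partial>M)"
    by (intro nn_integral_cong norm_powr_suminf_disjoint(2) disj)
  also have "\<dots> = (\<Sum>j. \<integral>\<^sup>+x. ennreal (norm (z j x) powr p) \<partial>M)"
    by (rule nn_integral_suminf) auto
  also have "\<dots> = (\<Sum>j. ennreal (Lp_pow M p (z j)))"
    by (simp only: nn_integral_Lp_pow[OF z])
  also have "\<dots> \<le> (\<Sum>j. ennreal (r j))"
    by (rule suminf_le) (simp_all add: r(2) ennreal_leI)
  also have "\<dots> = ennreal (\<Sum>j. r j)"
    by (rule suminf_ennreal2[OF r0 r(1)])
  finally have *: "(\<integral>\<^sup>+x. ennreal (norm (\<Sum>j. z j x) powr p) \<partial>M) \<le> ennreal (\<Sum>j. r j)" .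
  have m: "(\<lambda>x. \<Sum>j. z j x) \<in> borel_measurable M" by measurable
  show "(\<lambda>x. \<Sum>j. z j x) \<in> Lp_funs M p" "Lp_pow M p (\<lambda>x. \<Sum>j. z j x) \<le> (\<Sum>j. r j)"
    using Lp_funs_nn_integralI[OF m *] suminf_nonneg[OF r(1) r0] by auto
qed

subsection \<open>Supercyclicity on representatives, and the levels of a dissipative system\<close>

lemma powr_inverse_less_iff:
  fixes a e p :: real
  assumes "0 < p" "0 \<le> a" "0 < e"
  shows "a powr (1 / p) < e \<longleftrightarrow> a < e powr p"
proof -
  have "a powr (1 / p) < e \<longleftrightarrow> (a powr (1 / p)) powr p < e powr p"
    using powr_less_mono2[OF assms(1), of "a powr (1 / p)" e]
      powr_less_cancel2[OF assms(1), of "a powr (1 / p)" e] assms(3)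
      powr_mono2[of p e "a powr (1 / p)"] assms(1)
    by (smt (verit) powr_ge_zero)
  also have "(a powr (1 / p)) powr p = a"
    using assms by (simp add: powr_powr)
  finally show ?thesis .
qed

lemma all_powr_iff:
  assumes "0 < (p::real)"
  shows "(\<forall>e>0. P (e powr p)) \<longleftrightarrow> (\<forall>e>0. P e)"
proof (intro iffI allI impI)
  fix e :: real assume P: "\<forall>e>0. P (e powr p)" and e: "0 < e"
  have "P ((e powr (1 / p)) powr p)" using P e by auto
  then show "P e" using e assms by (simp add: powr_powr)
qed auto

lemma real_supercyclic_iff_norm:
  fixes d :: "'v \<Rightarrow> 'w \<Rightarrow> real" and T :: "'v \<Rightarrow> 'v" and N :: "real \<Rightarrow> nat \<Rightarrow> 'w \<Rightarrow> real"
  assumes d: "\<And>n l y. y \<in> E \<Longrightarrow> d (scl l ((T ^^ n) x)) y = N l n y powr (1 / p)"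
    and p: "0 < p" and N: "\<And>l n y. 0 \<le> N l n y"
  shows "(\<forall>y\<in>E. \<forall>e>0. \<exists>z\<in>{scl l ((T ^^ n) x) | l n. True}. d z y < e)
    \<longleftrightarrow> (\<forall>y\<in>E. \<forall>e>0. \<exists>l n. N l n y < e)"
proof (rule ball_cong[OF refl])
  fix y assume y: "y \<in> E"
  have "(\<forall>e>0. \<exists>z\<in>{scl l ((T ^^ n) x) | l n. True}. d z y < e)
      \<longleftrightarrow> (\<forall>e>0. \<exists>l n. N l n y powr (1 / p) < e)"
    by (simp add: d[OF y, symmetric]) blast
  also have "\<dots> \<longleftrightarrow> (\<forall>e>0. \<exists>l n. N l n y < e powr p)"
    using powr_inverse_less_iff[OF p N] by simp
  also have "\<dots> \<longleftrightarrow> (\<forall>e>0. \<exists>l n. N l n y < e)"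
    by (rule all_powr_iff[OF p])
  finally show "(\<forall>e>0. \<exists>z\<in>{scl l ((T ^^ n) x) | l n. True}. d z y < e)
      \<longleftrightarrow> (\<forall>e>0. \<exists>l n. N l n y < e)" .
qed

definition lp_pow :: "real \<Rightarrow> (int \<Rightarrow> complex) \<Rightarrow> real" where
  "lp_pow p x = (\<Sum>\<^sub>\<infinity>i. norm (x i) powr p)"

lemma lp_pow_nonneg: "0 \<le> lp_pow p x"
  by (simp add: lp_pow_def infsum_nonneg)

lemma real_supercyclic_lp_iff:
  assumes "0 < p"
  shows "real_supercyclic (lp_space p) (lp_dist p) lp_scale T \<longleftrightarrow>
    (\<exists>x\<in>lp_space p. \<forall>y\<in>lp_space p. \<forall>e>0. \<exists>l n. lp_pow p (\<lambda>i. of_real l * (T ^^ n) x i - y i) < e)"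
  unfolding real_supercyclic_def
proof (rule bex_cong[OF refl])
  fix x
  show "(\<forall>y\<in>lp_space p. \<forall>e>0. \<exists>z\<in>{lp_scale l ((T ^^ n) x) | l n. True}. lp_dist p z y < e) \<longleftrightarrow>
    (\<forall>y\<in>lp_space p. \<forall>e>0. \<exists>l n. lp_pow p (\<lambda>i. of_real l * (T ^^ n) x i - y i) < e)"
    by (rule real_supercyclic_iff_norm[where p = p])
      (auto simp: lp_dist_def lp_scale_def lp_pow_def[symmetric] assms lp_pow_nonneg)
qed

lemma Lp_norm_eq: "Lp_norm M p \<phi> = Lp_pow M p \<phi> powr (1 / p)"
  by (simp add: Lp_norm_def Lp_pow_def)

context composition_dynamical_system
begin

lemma space_UNIV [simp]: "space M = UNIV"
  using sets_eq_borel by (simp add: sets_eq_imp_space_eq)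

lemma comp_funpow_Lp_funs: "\<phi> \<in> Lp_funs M p \<Longrightarrow> \<phi> \<circ> (f ^^ n) \<in> Lp_funs M p"
proof (induction n)
  case (Suc n)
  then show ?case using comp_Lp_funs[of "\<phi> \<circ> (f ^^ n)" p] by (simp only: funpow_Suc_right o_assoc)
qed simp

lemma composition_operator_funpow_class:
  assumes "\<phi> \<in> Lp_funs M p"
  shows "(composition_operator M p f ^^ n) (Lp_eq M p `` {\<phi>}) = Lp_eq M p `` {\<phi> \<circ> (f ^^ n)}"
proof (induction n)
  case (Suc n)
  have "(composition_operator M p f ^^ Suc n) (Lp_eq M p `` {\<phi>})
      = composition_operator M p f (Lp_eq M p `` {\<phi> \<circ> (f ^^ n)})"
    by (simp only: Suc funpow.simps comp_def[of "composition_operator M p f"])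
  also have "\<dots> = Lp_eq M p `` {\<phi> \<circ> (f ^^ Suc n)}"
    by (simp only: composition_operator_class[OF comp_funpow_Lp_funs[OF assms, of n]]
        funpow_Suc_right o_assoc)
  finally show ?case .
qed simp

lemma real_supercyclic_Lp_iff:
  assumes "0 < p"
  shows "real_supercyclic (Lp_space M p) (Lp_dist M p) (Lp_scale M p) (composition_operator M p f) \<longleftrightarrow>
    (\<exists>\<phi>\<in>Lp_funs M p. \<forall>\<psi>\<in>Lp_funs M p. \<forall>e>0. \<exists>l n.
      Lp_pow M p (\<lambda>x. of_real l * \<phi> ((f ^^ n) x) - \<psi> x) < e)"
proof -
  let ?C = "\<lambda>\<phi>. Lp_eq M p `` {\<phi>}"
  have space: "Lp_space M p = ?C ` Lp_funs M p"
    by (auto simp: Lp_space_def quotient_def)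
  have d: "Lp_dist M p (Lp_scale M p l ((composition_operator M p f ^^ n) (?C \<phi>))) (?C \<psi>)
      = Lp_pow M p (\<lambda>x. of_real l * \<phi> ((f ^^ n) x) - \<psi> x) powr (1 / p)"
    if "\<phi> \<in> Lp_funs M p" "\<psi> \<in> Lp_funs M p" for \<phi> \<psi> l n
    using Lp_dist_class[OF Lp_scale_funs[OF comp_funpow_Lp_funs[OF that(1), of n], of l] that(2)]
    by (simp only: composition_operator_funpow_class[OF that(1)] Lp_norm_eq o_apply
        Lp_scale_class[OF comp_funpow_Lp_funs[OF that(1)]])
  have "(\<forall>y\<in>Lp_space M p. \<forall>e>0. \<exists>z\<in>{Lp_scale M p l ((composition_operator M p f ^^ n) (?C \<phi>)) | l n. True}.
        Lp_dist M p z y < e)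
      \<longleftrightarrow> (\<forall>\<psi>\<in>Lp_funs M p. \<forall>e>0. \<exists>l n. Lp_pow M p (\<lambda>x. of_real l * \<phi> ((f ^^ n) x) - \<psi> x) < e)"
    if \<phi>: "\<phi> \<in> Lp_funs M p" for \<phi>
  proof -
    have "(\<forall>\<psi>\<in>Lp_funs M p. \<forall>e>0.
          \<exists>z\<in>{Lp_scale M p l ((composition_operator M p f ^^ n) (?C \<phi>)) | l n. True}.
            Lp_dist M p z (?C \<psi>) < e)
        \<longleftrightarrow> (\<forall>\<psi>\<in>Lp_funs M p. \<forall>e>0. \<exists>l n. Lp_pow M p (\<lambda>x. of_real l * \<phi> ((f ^^ n) x) - \<psi> x) < e)"
      by (rule real_supercyclic_iff_norm[where d = "\<lambda>z \<psi>. Lp_dist M p z (?C \<psi>)" and p = p])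
        (simp_all only: d[OF \<phi>] assms Lp_pow_nonneg)
    then show ?thesis unfolding space by (simp only: Set.ball_simps)
  qed
  then show ?thesis
    unfolding real_supercyclic_def by (simp add: space)
qed

lemma int_iterate_0 [simp]: "int_iterate f 0 x = x"
  by (simp add: int_iterate_def)

lemma f_inv_f [simp]: "f (inv f x) = x" "inv f (f x) = x"
  using bij by (auto simp: bij_is_surj surj_f_inv_f bij_is_inj)

lemma int_iterate_succ: "int_iterate f (k + 1) x = f (int_iterate f k x)"
proof (cases "0 \<le> k")
  case True
  then have "nat (k + 1) = Suc (nat k)" by linarith
  then show ?thesis using True by (simp add: int_iterate_def)
next
  case False
  then have "nat (- k) = Suc (nat (- (k + 1)))" by linarith
  then show ?thesis using False by (auto simp: int_iterate_def)
qed

lemma int_iterate_pred: "int_iterate f (k - 1) x = inv f (int_iterate f k x)"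
  using int_iterate_succ[of "k - 1" x] by simp

lemma int_iterate_add: "int_iterate f (j + k) x = int_iterate f j (int_iterate f k x)"
proof (induction j rule: int_induct[where k = 0])
  case (step1 i)
  then show ?case
    using int_iterate_succ[of "i + k" x] int_iterate_succ[of i "int_iterate f k x"]
    by (simp add: add.commute add.left_commute)
next
  case (step2 i)
  then show ?case using int_iterate_pred[of "i + k" x] by (simp add: int_iterate_pred algebra_simps)
qed simp

lemma int_iterate_of_nat: "int_iterate f (int n) = f ^^ n"
  by (simp add: int_iterate_def)

lemma int_iterate_inverse [simp]:
  "int_iterate f k (int_iterate f (- k) x) = x" "int_iterate f (- k) (int_iterate f k x) = x"
  using int_iterate_add[of k "- k" x] int_iterate_add[of "- k" k x] by auto

lemma int_iterate_image: "int_iterate f k ` A = int_iterate f (- k) -` A"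
proof (intro set_eqI iffI)
  fix x assume "x \<in> int_iterate f (- k) -` A"
  then show "x \<in> int_iterate f k ` A"
    by (intro image_eqI[of _ _ "int_iterate f (- k) x"]) auto
qed auto

lemma mem_int_iterate_image: "int_iterate f j x \<in> int_iterate f k ` A \<longleftrightarrow> x \<in> int_iterate f (k - j) ` A"
  by (simp add: int_iterate_image int_iterate_add[symmetric])

lemma int_iterate_measurable [measurable]: "int_iterate f k \<in> measurable M M"
proof -
  have "g ^^ n \<in> measurable M M" if g [measurable]: "g \<in> measurable M M" for g and n :: nat
    by (induction n) (auto intro: measurable_comp[OF _ g])
  then show ?thesis
    using measurable_f measurable_inv_f by (simp add: int_iterate_def)
qed

lemma int_iterate_image_sets [measurable]: "A \<in> sets M \<Longrightarrow> int_iterate f k ` A \<in> sets M"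
  using measurable_sets[OF int_iterate_measurable, of A "- k"] by (simp add: int_iterate_image)

lemma composition_dynamical_system_inv: "composition_dynamical_system M (inv f)"
  using composition_dynamical_system_axioms
  by (simp add: composition_dynamical_system_def inv_inv_eq bij_imp_bij_inv)

lemma emeasure_image_le:
  "\<exists>C::real. C > 0 \<and> (\<forall>A\<in>sets M. emeasure M (f ` A) \<le> ennreal C * emeasure M A)"
  using composition_dynamical_system.emeasure_vimage_le[OF composition_dynamical_system_inv]
  by (simp add: bij_vimage_eq_inv_image bij_imp_bij_inv bij inv_inv_eq)

lemma emeasure_int_iterate_le:
  "\<exists>C::real. 0 < C \<and> (\<forall>A\<in>sets M. emeasure M (int_iterate f k ` A) \<le> ennreal C * emeasure M A)"
proof (induction k rule: int_induct[where k = 0])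
  case base
  show ?case by (intro exI[of _ 1]) simp
next
  case (step1 i)
  then obtain C D :: real where C: "C > 0" "D > 0"
    and le: "\<And>A. A \<in> sets M \<Longrightarrow> emeasure M (int_iterate f i ` A) \<le> ennreal C * emeasure M A"
      "\<And>A. A \<in> sets M \<Longrightarrow> emeasure M (f ` A) \<le> ennreal D * emeasure M A"
    using emeasure_image_le by blast
  have "emeasure M (int_iterate f (i + 1) ` A) \<le> ennreal (D * C) * emeasure M A" if A: "A \<in> sets M" for A
  proof -
    have "emeasure M (int_iterate f (i + 1) ` A) = emeasure M (f ` (int_iterate f i ` A))"
      by (simp add: image_image int_iterate_succ)
    also have "\<dots> \<le> ennreal D * (ennreal C * emeasure M A)"
      using le(2)[of "int_iterate f i ` A"] le(1)[OF A] A
      by (meson int_iterate_image_sets mult_left_mono order_trans zero_le)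
    finally show ?thesis using C by (simp add: ennreal_mult mult.assoc)
  qed
  then show ?case using C by (intro exI[of _ "D * C"]) simp
next
  case (step2 i)
  then obtain C D :: real where C: "C > 0" "D > 0"
    and le: "\<And>A. A \<in> sets M \<Longrightarrow> emeasure M (int_iterate f i ` A) \<le> ennreal C * emeasure M A"
      "\<And>A. A \<in> sets M \<Longrightarrow> emeasure M (f -` A) \<le> ennreal D * emeasure M A"
    using emeasure_vimage_le by blast
  have "emeasure M (int_iterate f (i - 1) ` A) \<le> ennreal (D * C) * emeasure M A" if A: "A \<in> sets M" for A
  proof -
    have "emeasure M (int_iterate f (i - 1) ` A) = emeasure M (f -` (int_iterate f i ` A))"
      by (simp add: bij_vimage_eq_inv_image bij image_image int_iterate_pred)
    also have "\<dots> \<le> ennreal D * (ennreal C * emeasure M A)"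
      using le(2)[of "int_iterate f i ` A"] le(1)[OF A] A
      by (meson int_iterate_image_sets mult_left_mono order_trans zero_le)
    finally show ?thesis using C by (simp add: ennreal_mult mult.assoc)
  qed
  then show ?case using C by (intro exI[of _ "D * C"]) simp
qed

end

context dissipative_system
begin

definition level :: "int \<Rightarrow> 'a set" where
  "level k = int_iterate f k ` W"

definition level_mass :: "int \<Rightarrow> real" where
  "level_mass k = measure M (level k)"

lemma level_sets [measurable]: "level k \<in> sets M"
  unfolding level_def using W_sets by (rule int_iterate_image_sets)

lemma mem_level_int_iterate: "int_iterate f j x \<in> level k \<longleftrightarrow> x \<in> level (k - j)"
  unfolding level_def by (rule mem_int_iterate_image)

lemma level_unique: "x \<in> level j \<Longrightarrow> x \<in> level k \<Longrightarrow> j = k"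
  using W_disjoint by (auto simp: level_def disjoint_family_on_def)

lemma in_some_level: "\<exists>k. x \<in> level k"
proof -
  have "x \<in> (\<Union>k. int_iterate f k ` W)" by (simp add: W_cover)
  then show ?thesis unfolding level_def by blast
qed

lemma emeasure_level_finite: "emeasure M (level k) < \<infinity>"
proof -
  obtain C where "emeasure M (level k) \<le> ennreal C * emeasure M W"
    using emeasure_int_iterate_le[of k] W_sets unfolding level_def by blast
  also have "\<dots> < \<infinity>" using W_finite by (simp add: ennreal_mult_less_top)
  finally show ?thesis .
qed

lemma emeasure_level: "emeasure M (level k) = ennreal (level_mass k)"
  using emeasure_level_finite[of k] by (simp add: level_mass_def emeasure_eq_ennreal_measure)

lemma level_mass_pos: "0 < level_mass k"
proof -
  obtain C where C: "emeasure M (int_iterate f (- k) ` level k) \<le> ennreal C * emeasure M (level k)"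
    using emeasure_int_iterate_le[of "- k"] level_sets by blast
  have "int_iterate f (- k) ` level k = W" by (simp add: level_def image_image)
  then have "emeasure M (level k) \<noteq> 0" using C W_pos by auto
  then show ?thesis
    by (simp add: emeasure_level) (metis emeasure_level ennreal_eq_0_iff not_le)
qed

lemma level_mass_pred_le: "\<exists>C>0. \<forall>k. level_mass (k - 1) \<le> C * level_mass k"
proof -
  obtain C :: real where C: "C > 0"
    "\<And>A. A \<in> sets M \<Longrightarrow> emeasure M (int_iterate f (- 1) ` A) \<le> ennreal C * emeasure M A"
    using emeasure_int_iterate_le[of "- 1"] by blast
  have "level_mass (k - 1) \<le> C * level_mass k" for k
  proof -
    have "level (k - 1) = int_iterate f (- 1) ` level k"
      unfolding level_def by (simp add: image_image int_iterate_add[symmetric])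
    then have "emeasure M (level (k - 1)) \<le> ennreal C * emeasure M (level k)"
      using C(2)[OF level_sets, of k] by simp
    then have "ennreal (level_mass (k - 1)) \<le> ennreal C * ennreal (level_mass k)"
      by (simp add: emeasure_level)
    then show ?thesis
      using C(1) level_mass_pos[of k] by (simp add: ennreal_mult[symmetric] less_imp_le)
  qed
  then show ?thesis using C(1) by blast
qed

end

subsection \<open>Supercyclic weighted shifts\<close>

lemma lp_space_lincomb:
  assumes "x \<in> lp_space p" "y \<in> lp_space p" "0 \<le> p"
  shows "(\<lambda>i. c * x i - y i) \<in> lp_space p"
proof -
  have "(\<lambda>i. 2 powr p * (norm c powr p * norm (x i) powr p + norm (y i) powr p)) summable_on UNIV"
    using assms(1,2) unfolding lp_space_def
    by (intro summable_on_cmult_right summable_on_add) auto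
  moreover have "norm (c * x i - y i) powr p
      \<le> 2 powr p * (norm c powr p * norm (x i) powr p + norm (y i) powr p)" for i
    using powr_norm_diff_le[OF assms(3), of "c * x i" "y i"] by (simp add: norm_mult powr_mult)
  ultimately have "(\<lambda>i. norm (c * x i - y i) powr p) summable_on UNIV"
    by (rule summable_on_comparison_test) auto
  then show ?thesis by (simp add: lp_space_def)
qed

lemma lp_space_finite_support: "finite {i. y i \<noteq> 0} \<Longrightarrow> y \<in> lp_space p"
  unfolding lp_space_def mem_Collect_eq
  by (rule finite_nonzero_values_imp_summable_on) (auto elim: rev_finite_subset)

lemma norm_powr_le_lp_pow:
  assumes "x \<in> lp_space p"
  shows "norm (x i) powr p \<le> lp_pow p x"
  using finite_sum_le_infsum[of "\<lambda>i. norm (x i) powr p" UNIV "{i}"] assms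
  by (simp add: lp_space_def lp_pow_def)

lemma norm_less_of_lp_pow_less:
  assumes "x \<in> lp_space p" "lp_pow p x < \<delta> powr p" "0 < p" "0 < \<delta>"
  shows "norm (x i) < \<delta>"
proof (rule ccontr)
  assume "\<not> norm (x i) < \<delta>"
  then have "\<delta> powr p \<le> norm (x i) powr p" using assms by (intro powr_mono2) auto
  then show False using norm_powr_le_lp_pow[OF assms(1), of i] assms(2) by linarith
qed

lemma backward_shift_quotient_funpow:
  fixes u :: "int \<Rightarrow> real"
  assumes "\<And>k. 0 < u k"
  shows "(backward_shift (\<lambda>k. u (k - 1) / u k) ^^ n) x i = of_real (u i / u (i + int n)) * x (i + int n)"
proof (induction n arbitrary: i)
  case (Suc n)
  have "u (i + 1) \<noteq> 0" "u i \<noteq> 0" using assms[of "i + 1"] assms[of i] by auto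
  then show ?case by (simp add: Suc backward_shift_def[of _ "(_ ^^ n) x"] add.assoc)
qed (simp add: less_imp_neq[OF assms, symmetric])

lemma lp_space_backward_shift:
  assumes "x \<in> lp_space p" "0 \<le> p" "\<And>k. \<bar>w k\<bar> \<le> C"
  shows "backward_shift w x \<in> lp_space p"
proof -
  have "(\<lambda>i. norm (x (i + 1)) powr p) summable_on UNIV"
    using assms(1) summable_on_reindex_bij_betw[of "\<lambda>i. i + 1" UNIV UNIV "\<lambda>i. norm (x i) powr p"]
    by (simp add: lp_space_def bij_plus_right)
  then have "(\<lambda>i. C powr p * norm (x (i + 1)) powr p) summable_on UNIV"
    by (rule summable_on_cmult_right)
  moreover have "norm (backward_shift w x i) powr p \<le> C powr p * norm (x (i + 1)) powr p" for i
  proof -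
    have "norm (backward_shift w x i) powr p = \<bar>w (i + 1)\<bar> powr p * norm (x (i + 1)) powr p"
      by (simp add: backward_shift_def norm_mult powr_mult)
    also have "\<dots> \<le> C powr p * norm (x (i + 1)) powr p"
      using assms(2,3) by (intro mult_right_mono powr_mono2) auto
    finally show ?thesis .
  qed
  ultimately have "(\<lambda>i. norm (backward_shift w x i) powr p) summable_on UNIV"
    by (rule summable_on_comparison_test) auto
  then show ?thesis by (simp add: lp_space_def)
qed

lemma quotient_avoids_finite:
  fixes c t :: complex
  assumes "finite F" "c \<noteq> 0" "t / c \<notin> F"
  obtains d where "0 < d" "\<And>a b. norm (a - c) < d \<Longrightarrow> norm (b - t) < d \<Longrightarrow> b / a \<notin> F"
proof -
  have "((\<lambda>z. snd z / fst z) \<longlongrightarrow> snd (c, t) / fst (c, t)) (nhds (c, t))"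
    using assms(2) by (intro tendsto_intros filterlim_ident) auto
  then have "eventually (\<lambda>z. snd z / fst z \<in> - F) (nhds (c, t))"
    using assms by (intro topological_tendstoD) (auto simp: finite_imp_closed)
  then obtain e where e: "0 < e" "\<And>z. dist z (c, t) < e \<Longrightarrow> snd z / fst z \<in> - F"
    by (auto simp: eventually_nhds_metric)
  show thesis
  proof (rule that[of "e / 2"])
    fix a b assume "norm (a - c) < e / 2" "norm (b - t) < e / 2"
    then have "dist a c < e / 2" "dist b t < e / 2" by (simp_all add: dist_norm)
    then have "dist (a, b) (c, t) < e"
      using sqrt_sum_squares_le_sum[of "dist a c" "dist b t"] by (simp add: dist_Pair_Pair)
    from e(2)[OF this] show "b / a \<notin> F" by simp
  qed (use e in simp)
qed

text \<open>
  The lines spanned by the first \<open>N\<close> orbit elements cannot come close to every small perturbation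
  of \<open>y\<close> in the direction of the \<open>j\<close>-th unit vector, which is how \<open>N \<le> n\<close> is enforced.
\<close>

lemma late_orbit_approximation:
  fixes v :: "nat \<Rightarrow> int \<Rightarrow> complex"
  assumes p: "0 < p" and v: "\<And>n. v n \<in> lp_space p"
    and dense: "\<And>y e. y \<in> lp_space p \<Longrightarrow> 0 < e \<Longrightarrow> \<exists>l n. lp_pow p (\<lambda>i. of_real l * v n i - y i) < e"
    and y: "y \<in> lp_space p" "y i \<noteq> 0" "y j = 0" and "0 < \<delta>"
  obtains l :: real and n where "N \<le> n" "\<And>i. norm (of_real l * v n i - y i) < \<delta>"
proof -
  have ij: "i \<noteq> j" using y by auto
  define F where "F = (\<lambda>n. v n j / v n i) ` {..<N}"
  have "inj_on (\<lambda>t::real. complex_of_real t / y i) {0<..<\<delta> / 2}"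
    using y(2) by (auto simp: inj_on_def)
  then have "infinite ((\<lambda>t::real. complex_of_real t / y i) ` {0<..<\<delta> / 2})"
    using \<open>0 < \<delta>\<close> by (simp add: finite_image_iff infinite_Ioo)
  then have "\<not> (\<lambda>t::real. complex_of_real t / y i) ` {0<..<\<delta> / 2} \<subseteq> F"
    using finite_subset unfolding F_def by blast
  then obtain t :: real where "t \<in> {0<..<\<delta> / 2}" and t: "of_real t / y i \<notin> F"
    by blast
  then have t: "0 < t" "t < \<delta> / 2" "of_real t / y i \<notin> F"
    by auto
  obtain d where d: "0 < d" "\<And>a b. norm (a - y i) < d \<Longrightarrow> norm (b - of_real t) < d \<Longrightarrow> b / a \<notin> F"
    using quotient_avoids_finite[of F "y i" "of_real t"] t(3) y(2) by (auto simp: F_def)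
  define r where "r = Min {d, norm (y i), \<delta> / 2}"
  have r: "0 < r" "r \<le> d" "r \<le> norm (y i)" "r \<le> \<delta> / 2"
    using d(1) y(2) \<open>0 < \<delta>\<close> by (auto simp: r_def)
  define y' where "y' = (\<lambda>k. y k + (if k = j then of_real t else 0))"
  have "y' = (\<lambda>k. 1 * y k - (if k = j then - of_real t else 0))"
    by (auto simp: y'_def)
  moreover have "(\<lambda>k. if k = j then - complex_of_real t else 0) \<in> lp_space p"
    by (rule lp_space_finite_support) simp
  ultimately have y': "y' \<in> lp_space p"
    using p lp_space_lincomb[OF y(1), where c = 1] by simp
  obtain l :: real and n where ln: "lp_pow p (\<lambda>k. of_real l * v n k - y' k) < r powr p"
    using dense[OF y', of "r powr p"] r(1) by auto
  have close: "norm (of_real l * v n k - y' k) < r" for k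
    by (rule norm_less_of_lp_pow_less[OF _ ln p r(1)]) (use p v y' in \<open>auto intro: lp_space_lincomb\<close>)
  have ci: "norm (of_real l * v n i - y i) < r" and cj: "norm (of_real l * v n j - of_real t) < r"
    using close[of i] close[of j] ij y(3) by (auto simp: y'_def)
  have "l \<noteq> 0" using ci r(3) by auto
  then have "v n j / v n i \<notin> F"
    using d(2)[of "of_real l * v n i" "of_real l * v n j"] ci cj r(2) by auto
  then have "N \<le> n" by (auto simp: F_def not_less[symmetric])
  moreover have "norm (of_real l * v n k - y k) < \<delta>" for k
  proof -
    have "norm (y' k - y k) < \<delta> / 2" using t by (simp add: y'_def)
    then show ?thesis
      using close[of k] r(4) norm_triangle_ineq[of "of_real l * v n k - y' k" "y' k - y k"] by simp
  qed
  ultimately show thesis by (rule that)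
qed

lemma supercyclic_backward_shift_imp:
  fixes u :: "int \<Rightarrow> real"
  assumes p: "0 < p" and u: "\<And>k. 0 < u k" and C: "\<And>k. u (k - 1) \<le> C * u k"
    and x: "x \<in> lp_space p"
    and dense: "\<And>y e. y \<in> lp_space p \<Longrightarrow> 0 < e \<Longrightarrow>
      \<exists>l n. lp_pow p (\<lambda>i. of_real l * (backward_shift (\<lambda>k. u (k - 1) / u k) ^^ n) x i - y i) < e"
    and \<epsilon>: "0 < \<epsilon>"
  obtains n :: nat where "N \<le> n" "\<And>i j. \<bar>i\<bar> \<le> int Q \<Longrightarrow> \<bar>j\<bar> \<le> int Q \<Longrightarrow> u (i - int n) * u (j + int n) < \<epsilon>"
proof -
  let ?T = "backward_shift (\<lambda>k. u (k - 1) / u k)"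
  let ?I = "{- int Q..int Q}"
  define v where "v = (\<lambda>n. (?T ^^ n) x)"
  define b where "b = (\<lambda>k. x k / of_real (u k))"
  have v_eq: "v n i = of_real (u i) * b (i + int n)" for n i
    using backward_shift_quotient_funpow[OF u, where n = n and x = x and i = i] by (simp add: v_def b_def)
  have "\<bar>u (k - 1) / u k\<bar> \<le> C" for k
    using C[of k] u[of k] u[of "k - 1"] by (simp add: divide_le_eq)
  then have v_lp: "v n \<in> lp_space p" for n
    unfolding v_def using p by (induction n) (auto intro!: x lp_space_backward_shift)
  define y where "y = (\<lambda>i. complex_of_real (if i \<in> ?I then u i else 0))"
  have "finite {i. y i \<noteq> 0}" by (rule finite_subset[of _ ?I]) (auto simp: y_def)
  then have y: "y \<in> lp_space p" "y 0 \<noteq> 0" "y (int Q + 1) = 0"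
    using lp_space_finite_support u[of 0] by (auto simp: y_def)
  define \<delta> where "\<delta> = min (sqrt \<epsilon> / 2) (Min (u ` ?I) / 2)"
  have "0 < Min (u ` ?I)" using u by (subst Min_gr_iff) auto
  then have \<delta>: "0 < \<delta>" using \<epsilon> by (simp add: \<delta>_def)
  have \<delta>u: "\<delta> \<le> u i / 2" if "i \<in> ?I" for i
  proof -
    have "Min (u ` ?I) \<le> u i" using that by (intro Min_le) auto
    then show ?thesis by (simp add: \<delta>_def)
  qed
  have "2 * \<delta> \<le> sqrt \<epsilon>" by (simp add: \<delta>_def)
  then have "(2 * \<delta>)\<^sup>2 \<le> (sqrt \<epsilon>)\<^sup>2" using \<delta> by (intro power_mono) auto
  then have \<delta>\<epsilon>: "4 * \<delta>\<^sup>2 \<le> \<epsilon>" using \<epsilon> by (simp add: power_mult_distrib)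
  have on: "1 / 2 \<le> \<bar>l\<bar> * norm (b (i + int n))"
    if l: "\<And>i. norm (of_real l * v n i - y i) < \<delta>" and i: "i \<in> ?I" for l n i
  proof -
    have "norm (y i) - norm (of_real l * v n i) < u i / 2"
      using l[of i] \<delta>u[OF i] norm_triangle_ineq3[of "of_real l * v n i" "y i"] by linarith
    then have "u i / 2 < u i * (\<bar>l\<bar> * norm (b (i + int n)))"
      using i u[of i] by (simp add: y_def v_eq norm_mult algebra_simps)
    then show ?thesis using u[of i] by simp
  qed
  have off: "\<bar>l\<bar> * u i * norm (b (i + int n)) < \<delta>"
    if l: "\<And>i. norm (of_real l * v n i - y i) < \<delta>" and i: "i \<notin> ?I" for l n i
    using l[of i] i u[of i] by (auto simp: y_def v_eq norm_mult algebra_simps split: if_splits)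
  have dense': "\<exists>l n. lp_pow p (\<lambda>i. of_real l * v n i - y i) < e" if "y \<in> lp_space p" "0 < e" for y e
    unfolding v_def by (rule dense[OF that])
  obtain l0 n0 where l0: "\<And>i. norm (of_real l0 * v n0 i - y i) < \<delta>"
    using late_orbit_approximation[OF p v_lp dense' y \<delta>, of 0] by blast
  obtain l1 n1 where n1: "n0 + max N (2 * Q + 1) \<le> n1"
    and l1: "\<And>i. norm (of_real l1 * v n1 i - y i) < \<delta>"
    using late_orbit_approximation[OF p v_lp dense' y \<delta>] by blast
  have n: "int (n1 - n0) = int n1 - int n0" using n1 by simp
  show thesis
  proof (rule that[of "n1 - n0"])
    fix i j :: int assume i: "\<bar>i\<bar> \<le> int Q" and j: "\<bar>j\<bar> \<le> int Q"
    let ?n = "int (n1 - n0)"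
    have a0: "1 / 2 \<le> \<bar>l0\<bar> * norm (b (i + int n0))"
      by (rule on[OF l0]) (use i in auto)
    have a1: "1 / 2 \<le> \<bar>l1\<bar> * norm (b (j + int n1))"
      by (rule on[OF l1]) (use j in auto)
    have pos: "0 < \<bar>l0\<bar>" "0 < \<bar>l1\<bar>" using a0 a1 by auto
    have "\<bar>l0\<bar> * u (j + ?n) * norm (b (j + ?n + int n0)) < \<delta>"
      by (rule off[OF l0]) (use n1 j in auto)
    then have c0: "\<bar>l0\<bar> * u (j + ?n) * norm (b (j + int n1)) < \<delta>" using n by simp
    have "\<bar>l1\<bar> * u (i - ?n) * norm (b (i - ?n + int n1)) < \<delta>"
      by (rule off[OF l1]) (use n1 i in auto)
    then have c1: "\<bar>l1\<bar> * u (i - ?n) * norm (b (i + int n0)) < \<delta>" using n by simp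
    have "\<bar>l0\<bar> * u (j + ?n) * (1 / 2) \<le> \<bar>l0\<bar> * u (j + ?n) * (\<bar>l1\<bar> * norm (b (j + int n1)))"
      using u[of "j + ?n"] by (intro mult_left_mono a1) auto
    also have "\<dots> = \<bar>l1\<bar> * (\<bar>l0\<bar> * u (j + ?n) * norm (b (j + int n1)))" by simp
    also have "\<dots> < \<bar>l1\<bar> * \<delta>" using pos c0 by (intro mult_strict_left_mono)
    finally have A: "\<bar>l0\<bar> * u (j + ?n) < 2 * \<bar>l1\<bar> * \<delta>" by simp
    have "\<bar>l1\<bar> * u (i - ?n) * (1 / 2) \<le> \<bar>l1\<bar> * u (i - ?n) * (\<bar>l0\<bar> * norm (b (i + int n0)))"
      using u[of "i - ?n"] by (intro mult_left_mono a0) auto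
    also have "\<dots> = \<bar>l0\<bar> * (\<bar>l1\<bar> * u (i - ?n) * norm (b (i + int n0)))" by simp
    also have "\<dots> < \<bar>l0\<bar> * \<delta>" using pos c1 by (intro mult_strict_left_mono)
    finally have B: "\<bar>l1\<bar> * u (i - ?n) < 2 * \<bar>l0\<bar> * \<delta>" by simp
    have "(\<bar>l1\<bar> * u (i - ?n)) * (\<bar>l0\<bar> * u (j + ?n)) < (2 * \<bar>l0\<bar> * \<delta>) * (2 * \<bar>l1\<bar> * \<delta>)"
      using u[of "j + ?n"] pos \<delta> by (intro mult_strict_mono A B mult_pos_pos mult_nonneg_nonneg) auto
    then have "(\<bar>l0\<bar> * \<bar>l1\<bar>) * (u (i - ?n) * u (j + ?n)) < (\<bar>l0\<bar> * \<bar>l1\<bar>) * (4 * \<delta>\<^sup>2)"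
      by (simp add: power2_eq_square mult_ac)
    then have "u (i - ?n) * u (j + ?n) < 4 * \<delta>\<^sup>2"
      using pos by (subst (asm) mult_less_cancel_left_pos) auto
    then show "u (i - ?n) * u (j + ?n) < \<epsilon>" using \<delta>\<epsilon> by linarith
  qed (use n1 in auto)
qed

subsection \<open>The factor map onto the weighted shift\<close>

lemma average_powr_le:
  fixes h :: "'a \<Rightarrow> complex"
  assumes p: "1 \<le> p" and [measurable]: "A \<in> sets M" "h \<in> borel_measurable M"
    and A: "emeasure M A < \<infinity>" "0 < measure M A"
    and int: "integrable M (\<lambda>x. indicator A x * norm (h x) powr p)"
  shows "integrable M (\<lambda>x. indicator A x * h x)"
    and "norm ((\<integral>x. indicator A x * h x \<partial>M) / measure M A) powr p
      \<le> 2 powr p * ((\<integral>x. indicator A x * norm (h x) powr p \<partial>M) / measure M A)"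
proof -
  let ?a = "measure M A" and ?I = "\<integral>x. indicator A x * norm (h x) powr p \<partial>M"
  have key: "t \<le> s + s powr (1 - p) * t powr p" if "0 < s" "0 \<le> t" for s t :: real
  proof (cases "t \<le> s")
    case False
    have "t = t powr (1 - p) * t powr p" using that False by (simp add: powr_add[symmetric])
    also have "\<dots> \<le> s powr (1 - p) * t powr p"
      using that False p by (intro mult_right_mono powr_mono2') auto
    finally show ?thesis using that by linarith
  qed (simp add: add_increasing2)
  have norm_indicator [simp]: "norm (indicator A x :: complex) = indicator A x" for x
    by (simp add: indicator_def)
  have intA: "integrable M (\<lambda>x. indicator A x :: real)"
    using A by (simp add: integrable_indicator_iff)
  have int_s: "integrable M (\<lambda>x. s * indicator A x + r * (indicator A x * norm (h x) powr p))" for s r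
    using int intA by auto
  show int_h: "integrable M (\<lambda>x. indicator A x * h x)"
    by (rule Bochner_Integration.integrable_bound[OF int_s[of 1 1]])
      (use key[of 1 "norm (h _)"] in \<open>auto simp: indicator_def norm_mult\<close>)
  define t where "t = (\<integral>x. indicator A x * norm (h x) \<partial>M) / ?a"
  have "norm (\<integral>x. indicator A x * h x \<partial>M) \<le> (\<integral>x. norm (indicator A x * h x) \<partial>M)"
    by (rule integral_norm_bound)
  also have "\<dots> = t * ?a" using A by (simp add: t_def norm_mult)
  finally have le_t: "norm ((\<integral>x. indicator A x * h x \<partial>M) / ?a) \<le> t"
    using A by (simp add: norm_divide divide_le_eq)
  then have "0 \<le> t" using norm_ge_zero order_trans by blast
  have "t powr p \<le> 2 powr p * (?I / ?a)"
  proof (cases "t = 0")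
    case False
    define s where "s = t / 2"
    have s: "0 < s" using False \<open>0 \<le> t\<close> by (simp add: s_def)
    have "(\<integral>x. indicator A x * norm (h x) \<partial>M)
        \<le> (\<integral>x. s * indicator A x + s powr (1 - p) * (indicator A x * norm (h x) powr p) \<partial>M)"
    proof (rule integral_mono[OF _ int_s])
      show "integrable M (\<lambda>x. indicator A x * norm (h x))"
        using integrable_norm[OF int_h] by (simp add: norm_mult)
      fix x show "indicator A x * norm (h x)
          \<le> s * indicator A x + s powr (1 - p) * (indicator A x * norm (h x) powr p)"
        using key[OF s, of "norm (h x)"] by (simp add: indicator_def)
    qed
    also have "\<dots> = s * ?a + s powr (1 - p) * ?I"
      using int intA A by simp
    finally have "t * ?a \<le> s * ?a + s powr (1 - p) * ?I" using A by (simp add: t_def)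
    then have "t \<le> s + s powr (1 - p) * (?I / ?a)" using A by (simp add: field_simps)
    then have "s \<le> s powr (1 - p) * (?I / ?a)" unfolding s_def by argo
    moreover have "s powr (1 - p) * s powr p = s" using s by (simp add: powr_add[symmetric])
    ultimately have "s powr (1 - p) * s powr p \<le> s powr (1 - p) * (?I / ?a)" by argo
    then have "s powr p \<le> ?I / ?a" using s by (subst (asm) mult_le_cancel_left_pos) simp_all
    moreover have "t powr p = 2 powr p * s powr p" using s by (simp add: s_def powr_mult[symmetric])
    ultimately show ?thesis using mult_left_mono[of "s powr p" "?I / ?a" "2 powr p"] by simp
  qed (use A in \<open>auto intro!: divide_nonneg_pos Bochner_Integration.integral_nonneg\<close>)
  then show "norm ((\<integral>x. indicator A x * h x \<partial>M) / ?a) powr p \<le> 2 powr p * (?I / ?a)"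
    using le_t p by (meson norm_ge_zero order_trans powr_mono2 zero_le_one)
qed

context dissipative_system
begin

lemma level_0 [simp]: "level 0 = W"
  by (simp add: level_def)

definition level_weight :: "real \<Rightarrow> int \<Rightarrow> real" where
  "level_weight p k = level_mass k powr (1 / p)"

lemma level_weight_pos: "0 < level_weight p k"
  using level_mass_pos[of k] by (simp add: level_weight_def)

lemma level_weight_powr: "0 < p \<Longrightarrow> level_weight p k powr p = level_mass k"
  using level_mass_pos[of k] by (simp add: level_weight_def powr_powr)

lemma system_weights_eq: "system_weights M f W p = (\<lambda>k. level_weight p (k - 1) / level_weight p k)"
  by (simp add: fun_eq_iff system_weights_def level_weight_def powr_divide level_mass_def level_def)

lemma level_weight_pred_le:
  assumes "0 < p"
  obtains C where "\<And>k. level_weight p (k - 1) \<le> C * level_weight p k"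
proof -
  obtain C where C: "0 < C" "\<And>k. level_mass (k - 1) \<le> C * level_mass k"
    using level_mass_pred_le by blast
  show thesis
  proof (rule that)
    fix k
    have "level_mass (k - 1) powr (1 / p) \<le> (C * level_mass k) powr (1 / p)"
      using C(2)[of k] level_mass_pos[of "k - 1"] assms by (intro powr_mono2) auto
    then show "level_weight p (k - 1) \<le> C powr (1 / p) * level_weight p k"
      by (simp add: level_weight_def powr_mult)
  qed
qed

definition step_function :: "(int \<Rightarrow> complex) \<Rightarrow> 'a \<Rightarrow> complex" where
  "step_function c x = (\<Sum>n. c (int_decode n) * indicator (level (int_decode n)) x)"

lemma step_function_eq:
  assumes "x \<in> level k"
  shows "step_function c x = c k"
proof -
  have "step_function c x = (\<Sum>n\<in>{int_encode k}. c (int_decode n) * indicator (level (int_decode n)) x)"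
    unfolding step_function_def
  proof (rule suminf_finite)
    fix n assume "n \<notin> {int_encode k}"
    then have "int_decode n \<noteq> k" by auto
    then have "x \<notin> level (int_decode n)" using level_unique[OF assms] by metis
    then show "c (int_decode n) * indicator (level (int_decode n)) x = 0" by simp
  qed simp
  then show ?thesis using assms by simp
qed

lemma step_function_Lp_funs:
  assumes p: "0 < p" and y: "y \<in> lp_space p"
  shows "step_function (\<lambda>k. y k / level_weight p k) \<in> Lp_funs M p"
proof -
  define z where "z = (\<lambda>n x. y (int_decode n) / level_weight p (int_decode n) * indicator (level (int_decode n)) x)"
  have norm_z: "(\<lambda>x. norm (z n x) powr p)
      = (\<lambda>x. norm (y (int_decode n)) powr p / level_mass (int_decode n) * indicator (level (int_decode n)) x)" for n
    using p level_weight_pos[of p "int_decode n"]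
    by (auto simp: fun_eq_iff z_def norm_mult norm_divide powr_mult powr_divide level_weight_powr
        indicator_def)
  have int: "integrable M (indicator (level k) :: _ \<Rightarrow> real)" for k
    using emeasure_level_finite[of k] by (simp add: integrable_indicator_iff)
  have z: "z n \<in> Lp_funs M p" for n
    using int by (simp add: Lp_funs_def norm_z) (simp add: z_def)
  have pow: "Lp_pow M p (z n) = norm (y (int_decode n)) powr p" for n
    using level_mass_pos[of "int_decode n"] by (simp add: Lp_pow_def norm_z level_mass_def[symmetric])
  have "(\<lambda>n. norm (y (int_decode n)) powr p) summable_on UNIV"
    using y summable_on_reindex_bij_betw[OF bij_int_decode, of "\<lambda>i. norm (y i) powr p"]
    by (simp add: lp_space_def)
  then have "summable (\<lambda>n. norm (y (int_decode n)) powr p)"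
    by (rule summable_on_imp_summable)
  moreover have "i = j" if "z i x \<noteq> 0" "z j x \<noteq> 0" for i j x
  proof -
    have "x \<in> level (int_decode i)" "x \<in> level (int_decode j)"
      using that by (auto simp: z_def indicator_def split: if_splits)
    then have "int_decode i = int_decode j" by (rule level_unique)
    then show ?thesis by (metis int_decode_inverse)
  qed
  ultimately have "(\<lambda>x. \<Sum>n. z n x) \<in> Lp_funs M p"
    using Lp_funs_suminf_disjoint(1)[of z M p "\<lambda>n. norm (y (int_decode n)) powr p"] z pow by simp
  then show ?thesis by (simp add: z_def step_function_def[abs_def])
qed

definition level_average :: "int \<Rightarrow> ('a \<Rightarrow> complex) \<Rightarrow> complex" where
  "level_average k \<phi> = (\<integral>x. indicator W x * \<phi> (int_iterate f k x) \<partial>M) / measure M W"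

lemma measure_W: "measure M W = level_mass 0"
  by (simp add: level_mass_def)

end

context bounded_distortion_system
begin

lemma distortion_lower:
  obtains K :: real where "0 < K" "\<And>k h. h \<in> borel_measurable M \<Longrightarrow>
    (\<integral>\<^sup>+x. h (int_iterate f k x) * indicator W x \<partial>M)
      \<le> ennreal (K * level_mass 0 / level_mass k) * (\<integral>\<^sup>+x. h x * indicator (level k) x \<partial>M)"
proof -
  obtain K :: real where K: "0 < K" and dist: "\<And>k B. B \<in> sets M \<Longrightarrow> B \<subseteq> W \<Longrightarrow> emeasure M B > 0 \<Longrightarrow>
      ennreal (1 / K) * emeasure M (int_iterate f k ` W) * emeasure M B
        \<le> emeasure M (int_iterate f k ` B) * emeasure M W"
    using bounded_distortion by blast
  show thesis
  proof (rule that[OF K])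
    fix k :: int and h :: "'a \<Rightarrow> ennreal" assume [measurable]: "h \<in> borel_measurable M"
    note [measurable] = W_sets
    let ?c = "K * level_mass 0 / level_mass k"
    let ?N1 = "distr (density M (indicator W)) M (int_iterate f k)"
    let ?N2 = "scale_measure (ennreal ?c) (density M (indicator (level k)))"
    have le: "emeasure M (W \<inter> int_iterate f k -` A) \<le> ennreal ?c * emeasure M (level k \<inter> A)"
      if A: "A \<in> sets M" for A
    proof -
      let ?B = "W \<inter> int_iterate f k -` A"
      have B: "?B \<in> sets M" using measurable_sets[OF int_iterate_measurable A] W_sets by simp
      have img: "int_iterate f k ` ?B = level k \<inter> A" by (auto simp: level_def)
      have fin: "emeasure M ?B < \<infinity>" "emeasure M (level k \<inter> A) < \<infinity>"
        using emeasure_mono[of ?B W M] emeasure_mono[of "level k \<inter> A" "level k" M] W_sets W_finite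
          emeasure_level_finite[of k] level_sets[of k] by (auto intro: le_less_trans)
      then have eq: "emeasure M ?B = ennreal (measure M ?B)"
        "emeasure M (level k \<inter> A) = ennreal (measure M (level k \<inter> A))"
        by (auto simp: emeasure_eq_ennreal_measure)
      show ?thesis
      proof (cases "emeasure M ?B = 0")
        case False
        then have "ennreal (1 / K) * emeasure M (level k) * emeasure M ?B
            \<le> emeasure M (level k \<inter> A) * emeasure M (level 0)"
          using dist[OF B, of k] img by (simp add: level_def zero_less_iff_neq_zero)
        then have "1 / K * level_mass k * measure M ?B \<le> measure M (level k \<inter> A) * level_mass 0"
          using K level_mass_pos[of k] level_mass_pos[of 0]
          by (simp only: emeasure_level eq) (simp add: ennreal_mult[symmetric] less_imp_le)
        then have "measure M ?B \<le> ?c * measure M (level k \<inter> A)"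
          using K level_mass_pos[of k] by (simp add: field_simps)
        then show ?thesis
          using K level_mass_pos[of k] level_mass_pos[of 0]
          by (simp only: eq) (simp add: ennreal_mult[symmetric] less_imp_le ennreal_leI)
      qed simp
    qed
    have "(\<integral>\<^sup>+x. h (int_iterate f k x) * indicator W x \<partial>M) = (\<integral>\<^sup>+x. h x \<partial>?N1)"
      by (simp add: nn_integral_distr nn_integral_density mult.commute)
    also have "\<dots> \<le> (\<integral>\<^sup>+x. h x \<partial>?N2)"
    proof (rule nn_integral_mono_measure)
      have "emeasure ?N1 A \<le> emeasure ?N2 A" if A: "A \<in> sets M" for A
      proof -
        have vA: "int_iterate f k -` A \<in> sets M" using measurable_sets[OF int_iterate_measurable A] by simp
        have "emeasure ?N1 A = emeasure M (W \<inter> int_iterate f k -` A)"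
          using A vA W_sets
          by (simp add: emeasure_distr emeasure_density indicator_inter_arith[symmetric])
        moreover have "emeasure ?N2 A = ennreal ?c * emeasure M (level k \<inter> A)"
          using A by (simp add: emeasure_density indicator_inter_arith[symmetric])
        ultimately show ?thesis using le[OF A] by simp
      qed
      then show "?N1 \<le> ?N2" by (subst le_measure) auto
    qed simp
    also have "\<dots> = ennreal ?c * (\<integral>\<^sup>+x. h x * indicator (level k) x \<partial>M)"
      by (simp add: nn_integral_scale_measure nn_integral_density mult.commute)
    finally show "(\<integral>\<^sup>+x. h (int_iterate f k x) * indicator W x \<partial>M)
      \<le> ennreal ?c * (\<integral>\<^sup>+x. h x * indicator (level k) x \<partial>M)" .
  qed
qed

lemma level_average_bound:
  assumes p: "1 \<le> p"
  obtains K :: real where "0 < K"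
    "\<And>\<phi> k. \<phi> \<in> Lp_funs M p \<Longrightarrow> integrable M (\<lambda>x. indicator W x * \<phi> (int_iterate f k x))"
    "\<And>\<phi> k. \<phi> \<in> Lp_funs M p \<Longrightarrow> norm (level_weight p k * level_average k \<phi>) powr p
      \<le> K * (\<integral>x. indicator (level k) x * norm (\<phi> x) powr p \<partial>M)"
proof -
  obtain K :: real where K: "0 < K" and lower: "\<And>k h. h \<in> borel_measurable M \<Longrightarrow>
    (\<integral>\<^sup>+x. h (int_iterate f k x) * indicator W x \<partial>M)
      \<le> ennreal (K * level_mass 0 / level_mass k) * (\<integral>\<^sup>+x. h x * indicator (level k) x \<partial>M)"
    using distortion_lower by blast
  have *: "integrable M (\<lambda>x. indicator W x * norm (\<phi> (int_iterate f k x)) powr p) \<and>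
      (\<integral>x. indicator W x * norm (\<phi> (int_iterate f k x)) powr p \<partial>M)
        \<le> K * level_mass 0 / level_mass k * (\<integral>x. indicator (level k) x * norm (\<phi> x) powr p \<partial>M)"
    if \<phi>: "\<phi> \<in> Lp_funs M p" for \<phi> k
  proof -
    have [measurable]: "\<phi> \<in> borel_measurable M" and int: "integrable M (\<lambda>x. norm (\<phi> x) powr p)"
      using \<phi> by (auto simp: Lp_funs_def)
    note [measurable] = W_sets
    have int_k: "integrable M (\<lambda>x. indicator (level k) x * norm (\<phi> x) powr p)"
      by (rule Bochner_Integration.integrable_bound[OF int]) (auto simp: indicator_def)
    have "(\<integral>\<^sup>+x. ennreal (indicator W x * norm (\<phi> (int_iterate f k x)) powr p) \<partial>M)
        = (\<integral>\<^sup>+x. ennreal (norm (\<phi> (int_iterate f k x)) powr p) * indicator W x \<partial>M)"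
      by (intro nn_integral_cong) (auto simp: indicator_def)
    also have "\<dots> \<le> ennreal (K * level_mass 0 / level_mass k) *
        (\<integral>\<^sup>+x. ennreal (norm (\<phi> x) powr p) * indicator (level k) x \<partial>M)"
      by (rule lower) measurable
    also have "(\<integral>\<^sup>+x. ennreal (norm (\<phi> x) powr p) * indicator (level k) x \<partial>M)
        = (\<integral>\<^sup>+x. ennreal (indicator (level k) x * norm (\<phi> x) powr p) \<partial>M)"
      by (intro nn_integral_cong) (auto simp: indicator_def)
    also have "\<dots> = ennreal (\<integral>x. indicator (level k) x * norm (\<phi> x) powr p \<partial>M)"
      by (rule nn_integral_eq_integral[OF int_k]) auto
    also have "ennreal (K * level_mass 0 / level_mass k) * \<dots>
        = ennreal (K * level_mass 0 / level_mass k * (\<integral>x. indicator (level k) x * norm (\<phi> x) powr p \<partial>M))"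
      using K level_mass_pos[of 0] level_mass_pos[of k]
      by (intro ennreal_mult[symmetric]) (auto intro!: Bochner_Integration.integral_nonneg)
    finally have le: "(\<integral>\<^sup>+x. ennreal (indicator W x * norm (\<phi> (int_iterate f k x)) powr p) \<partial>M)
      \<le> ennreal (K * level_mass 0 / level_mass k * (\<integral>x. indicator (level k) x * norm (\<phi> x) powr p \<partial>M))" .
    have int_W: "integrable M (\<lambda>x. indicator W x * norm (\<phi> (int_iterate f k x)) powr p)"
      using le by (intro integrableI_bounded) (auto intro: le_less_trans)
    have nn: "0 \<le> K * level_mass 0 / level_mass k * (\<integral>x. indicator (level k) x * norm (\<phi> x) powr p \<partial>M)"
      using K level_mass_pos[of 0] level_mass_pos[of k]
      by (intro mult_nonneg_nonneg divide_nonneg_pos Bochner_Integration.integral_nonneg) auto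
    have "(\<integral>\<^sup>+x. ennreal (indicator W x * norm (\<phi> (int_iterate f k x)) powr p) \<partial>M)
        = ennreal (\<integral>x. indicator W x * norm (\<phi> (int_iterate f k x)) powr p \<partial>M)"
      by (rule nn_integral_eq_integral[OF int_W]) auto
    then show ?thesis
      using le int_W by (simp only: ennreal_le_iff[OF nn])
  qed
  show thesis
  proof (rule that[of "2 powr p * K"])
    fix \<phi> k assume \<phi>: "\<phi> \<in> Lp_funs M p"
    have [measurable]: "\<phi> \<in> borel_measurable M" using \<phi> by (auto simp: Lp_funs_def)
    have meas: "(\<lambda>x. \<phi> (int_iterate f k x)) \<in> borel_measurable M" by measurable
    have pos: "0 < measure M W" using level_mass_pos[of 0] by (simp add: measure_W)
    note avg = average_powr_le[OF p W_sets meas W_finite pos *[OF \<phi>, THEN conjunct1]]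
    show "integrable M (\<lambda>x. indicator W x * \<phi> (int_iterate f k x))" by (rule avg(1))
    let ?I = "\<integral>x. indicator (level k) x * norm (\<phi> x) powr p \<partial>M"
    have "norm (level_weight p k * level_average k \<phi>) powr p
        = level_mass k * norm (level_average k \<phi>) powr p"
      using p level_weight_pos[of p k] by (simp add: norm_mult powr_mult level_weight_powr)
    also have "\<dots> \<le> level_mass k * (2 powr p *
        ((\<integral>x. indicator W x * norm (\<phi> (int_iterate f k x)) powr p \<partial>M) / measure M W))"
      unfolding level_average_def using level_mass_pos[of k] by (intro mult_left_mono avg(2)) auto
    also have "\<dots> \<le> level_mass k * (2 powr p * ((K * level_mass 0 / level_mass k * ?I) / measure M W))"
      using level_mass_pos[of k] pos *[OF \<phi>, of k]
      by (intro mult_left_mono divide_right_mono) auto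
    also have "\<dots> = 2 powr p * K * ?I"
      using level_mass_pos[of k] level_mass_pos[of 0] by (simp add: measure_W)
    finally show "norm (level_weight p k * level_average k \<phi>) powr p \<le> 2 powr p * K * ?I" .
  qed (use K in simp)
qed

lemma sum_level_integral_le:
  assumes "\<phi> \<in> Lp_funs M p" "finite F"
  shows "(\<Sum>k\<in>F. \<integral>x. indicator (level k) x * norm (\<phi> x) powr p \<partial>M) \<le> Lp_pow M p \<phi>"
proof -
  have [measurable]: "\<phi> \<in> borel_measurable M" and int: "integrable M (\<lambda>x. norm (\<phi> x) powr p)"
    using assms by (auto simp: Lp_funs_def)
  have int_k: "integrable M (\<lambda>x. indicator (level k) x * norm (\<phi> x) powr p)" for k
    by (rule Bochner_Integration.integrable_bound[OF int]) (auto simp: indicator_def)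
  have "(\<Sum>k\<in>F. \<integral>x. indicator (level k) x * norm (\<phi> x) powr p \<partial>M)
      = (\<integral>x. (\<Sum>k\<in>F. indicator (level k) x * norm (\<phi> x) powr p) \<partial>M)"
    using int_k by simp
  also have "\<dots> \<le> (\<integral>x. norm (\<phi> x) powr p \<partial>M)"
  proof (rule integral_mono[OF _ int])
    show "integrable M (\<lambda>x. \<Sum>k\<in>F. indicator (level k) x * norm (\<phi> x) powr p)"
      using int_k by auto
    fix x
    obtain k where k: "x \<in> level k" using in_some_level by blast
    have "indicator (level j) x = (if j = k then 1 else 0 :: real)" for j
      using k by (auto simp: indicator_def dest: level_unique[OF k])
    then have "(\<Sum>k\<in>F. indicator (level k) x :: real) \<le> 1"
      using assms(2) by simp
    then have "(\<Sum>k\<in>F. indicator (level k) x) * norm (\<phi> x) powr p \<le> 1 * norm (\<phi> x) powr p"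
      by (intro mult_right_mono) auto
    then show "(\<Sum>k\<in>F. indicator (level k) x * norm (\<phi> x) powr p) \<le> norm (\<phi> x) powr p"
      by (simp add: sum_distrib_right)
  qed
  finally show ?thesis by (simp add: Lp_pow_def)
qed

lemma factor_map_bound:
  assumes p: "1 \<le> p"
  obtains K :: real where "0 < K"
    "\<And>\<phi>. \<phi> \<in> Lp_funs M p \<Longrightarrow> (\<lambda>k. level_weight p k * level_average k \<phi>) \<in> lp_space p"
    "\<And>\<phi>. \<phi> \<in> Lp_funs M p \<Longrightarrow> lp_pow p (\<lambda>k. level_weight p k * level_average k \<phi>) \<le> K * Lp_pow M p \<phi>"
proof -
  obtain K :: real where K: "0 < K" and bd: "\<And>\<phi> k. \<phi> \<in> Lp_funs M p \<Longrightarrow>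
      norm (level_weight p k * level_average k \<phi>) powr p
      \<le> K * (\<integral>x. indicator (level k) x * norm (\<phi> x) powr p \<partial>M)"
    using level_average_bound[OF p] by metis
  have sum: "(\<Sum>k\<in>F. norm (level_weight p k * level_average k \<phi>) powr p) \<le> K * Lp_pow M p \<phi>"
    if "\<phi> \<in> Lp_funs M p" "finite F" for \<phi> F
  proof -
    have "(\<Sum>k\<in>F. norm (level_weight p k * level_average k \<phi>) powr p)
        \<le> (\<Sum>k\<in>F. K * (\<integral>x. indicator (level k) x * norm (\<phi> x) powr p \<partial>M))"
      by (intro sum_mono bd that)
    also have "\<dots> = K * (\<Sum>k\<in>F. \<integral>x. indicator (level k) x * norm (\<phi> x) powr p \<partial>M)"
      by (simp add: sum_distrib_left)
    also have "\<dots> \<le> K * Lp_pow M p \<phi>"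
      using K by (intro mult_left_mono sum_level_integral_le that) auto
    finally show ?thesis .
  qed
  have summable: "(\<lambda>k. norm (level_weight p k * level_average k \<phi>) powr p) summable_on UNIV"
    if "\<phi> \<in> Lp_funs M p" for \<phi>
    by (rule nonneg_bdd_above_summable_on) (use sum[OF that] in \<open>auto intro!: bdd_aboveI\<close>)
  show thesis
  proof (rule that[OF K])
    fix \<phi> assume \<phi>: "\<phi> \<in> Lp_funs M p"
    show "(\<lambda>k. level_weight p k * level_average k \<phi>) \<in> lp_space p"
      using summable[OF \<phi>] by (simp add: lp_space_def)
    show "lp_pow p (\<lambda>k. level_weight p k * level_average k \<phi>) \<le> K * Lp_pow M p \<phi>"
      unfolding lp_pow_def by (rule infsum_le_finite_sums[OF summable[OF \<phi>]]) (rule sum[OF \<phi>])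
  qed
qed

lemma level_average_orbit_minus_step:
  assumes p: "1 \<le> p" and \<phi>: "\<phi> \<in> Lp_funs M p"
    and c: "step_function c \<in> Lp_funs M p"
  shows "level_average k (\<lambda>x. l * \<phi> ((f ^^ n) x) - step_function c x)
    = l * level_average (k + int n) \<phi> - c k"
proof -
  have int: "integrable M (\<lambda>x. indicator W x * \<theta> (int_iterate f k x))" if "\<theta> \<in> Lp_funs M p" for \<theta> k
    using level_average_bound[OF p] that by metis
  have shift: "(f ^^ n) (int_iterate f k x) = int_iterate f (k + int n) x" for x
    using int_iterate_add[of "int n" k x] by (simp add: int_iterate_of_nat add.commute)
  have step: "(\<lambda>x. indicator W x * step_function c (int_iterate f k x)) = (\<lambda>x. indicator W x * c k)"
  proof
    fix x
    have "int_iterate f k x \<in> level k" if "x \<in> W" using that by (simp add: mem_level_int_iterate)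
    then show "indicator W x * step_function c (int_iterate f k x) = indicator W x * c k"
      by (auto simp: indicator_def step_function_eq)
  qed
  have "(\<integral>x. indicator W x * (l * \<phi> ((f ^^ n) (int_iterate f k x)) - step_function c (int_iterate f k x)) \<partial>M)
      = (\<integral>x. l * (indicator W x * \<phi> (int_iterate f (k + int n) x))
          - indicator W x * step_function c (int_iterate f k x) \<partial>M)"
    by (intro Bochner_Integration.integral_cong refl) (simp add: shift algebra_simps)
  also have "\<dots> = l * (\<integral>x. indicator W x * \<phi> (int_iterate f (k + int n) x) \<partial>M)
      - (\<integral>x. indicator W x * step_function c (int_iterate f k x) \<partial>M)"
    using int[OF \<phi>, of "k + int n"] int[OF c, of k] by simp
  also have "(\<integral>x. indicator W x * step_function c (int_iterate f k x) \<partial>M) = measure M W * c k"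
  proof -
    have "(\<lambda>x. indicator W x * c k) = (\<lambda>x. indicator W x *\<^sub>R c k)"
      by (auto simp: indicator_def)
    then show ?thesis
      using W_sets W_finite unfolding step by (simp add: scaleR_conv_of_real integrable_indicator_iff)
  qed
  finally show ?thesis
    using level_mass_pos[of 0] by (simp add: level_average_def measure_W diff_divide_distrib)
qed

lemma supercyclic_composition_imp_shift:
  assumes p: "1 \<le> p"
    and "real_supercyclic (Lp_space M p) (Lp_dist M p) (Lp_scale M p) (composition_operator M p f)"
  shows "real_supercyclic (lp_space p) (lp_dist p) lp_scale (backward_shift (system_weights M f W p))"
proof -
  have p0: "0 < p" using p by simp
  obtain \<phi> where \<phi>: "\<phi> \<in> Lp_funs M p" and dense: "\<And>\<psi> e. \<psi> \<in> Lp_funs M p \<Longrightarrow> 0 < e \<Longrightarrow>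
      \<exists>l n. Lp_pow M p (\<lambda>x. of_real l * \<phi> ((f ^^ n) x) - \<psi> x) < e"
    using assms(2) unfolding real_supercyclic_Lp_iff[OF p0] by blast
  obtain K :: real where K: "0 < K"
    and G: "\<And>\<phi>. \<phi> \<in> Lp_funs M p \<Longrightarrow> (\<lambda>k. level_weight p k * level_average k \<phi>) \<in> lp_space p"
      "\<And>\<phi>. \<phi> \<in> Lp_funs M p \<Longrightarrow> lp_pow p (\<lambda>k. level_weight p k * level_average k \<phi>) \<le> K * Lp_pow M p \<phi>"
    using factor_map_bound[OF p] by blast
  let ?x = "\<lambda>k. level_weight p k * level_average k \<phi>"
  let ?T = "backward_shift (system_weights M f W p)"
  have "\<exists>l n. lp_pow p (\<lambda>i. of_real l * (?T ^^ n) ?x i - y i) < e" if y: "y \<in> lp_space p" and e: "0 < e" for y e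
  proof -
    let ?\<psi> = "step_function (\<lambda>k. y k / level_weight p k)"
    have \<psi>: "?\<psi> \<in> Lp_funs M p" by (rule step_function_Lp_funs[OF p0 y])
    obtain l :: real and n where ln: "Lp_pow M p (\<lambda>x. of_real l * \<phi> ((f ^^ n) x) - ?\<psi> x) < e / K"
      using dense[OF \<psi>, of "e / K"] e K by auto
    have diff: "(\<lambda>x. of_real l * \<phi> ((f ^^ n) x) - ?\<psi> x) \<in> Lp_funs M p"
      using p0 by (intro Lp_funs_diff(1) Lp_funs_cmult \<psi> comp_funpow_Lp_funs[OF \<phi>, unfolded comp_def]) auto
    have "(\<lambda>i. of_real l * (?T ^^ n) ?x i - y i)
        = (\<lambda>k. level_weight p k * level_average k (\<lambda>x. of_real l * \<phi> ((f ^^ n) x) - ?\<psi> x))"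
    proof
      fix k
      have "level_weight p k \<noteq> 0" "level_weight p (k + int n) \<noteq> 0"
        using level_weight_pos[of p k] level_weight_pos[of p "k + int n"] by auto
      then show "of_real l * (?T ^^ n) ?x k - y k
          = level_weight p k * level_average k (\<lambda>x. of_real l * \<phi> ((f ^^ n) x) - ?\<psi> x)"
        unfolding level_average_orbit_minus_step[OF p \<phi> \<psi>] system_weights_eq
          backward_shift_quotient_funpow[where u = "level_weight p", OF level_weight_pos]
        by (simp add: field_simps)
    qed
    then have "lp_pow p (\<lambda>i. of_real l * (?T ^^ n) ?x i - y i)
        \<le> K * Lp_pow M p (\<lambda>x. of_real l * \<phi> ((f ^^ n) x) - ?\<psi> x)"
      using G(2)[OF diff] by simp
    also have "\<dots> < e" using ln K by (simp add: less_divide_eq mult.commute)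
    finally show ?thesis by blast
  qed
  then show ?thesis
    unfolding real_supercyclic_lp_iff[OF p0] using G(1)[OF \<phi>] by blast
qed

end

subsection \<open>A dense sequence in \<open>L\<^sup>p\<close>\<close>

definition Lp_closure :: "'a measure \<Rightarrow> real \<Rightarrow> ('a \<Rightarrow> complex) set \<Rightarrow> ('a \<Rightarrow> complex) set" where
  "Lp_closure M p D = {\<phi> \<in> Lp_funs M p. \<forall>e>0. \<exists>d\<in>D. Lp_pow M p (\<lambda>x. \<phi> x - d x) < e}"

lemma Lp_closure_superset: "D \<subseteq> Lp_funs M p \<Longrightarrow> d \<in> D \<Longrightarrow> d \<in> Lp_closure M p D"
  by (auto simp: Lp_closure_def Lp_pow_def intro!: bexI[of _ d])

lemma Lp_closure_closed:
  assumes p: "0 < p" and D: "D \<subseteq> Lp_funs M p" and \<phi>: "\<phi> \<in> Lp_funs M p"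
    and approx: "\<And>e. 0 < e \<Longrightarrow> \<exists>\<psi>\<in>Lp_closure M p D. Lp_pow M p (\<lambda>x. \<phi> x - \<psi> x) < e"
  shows "\<phi> \<in> Lp_closure M p D"
proof -
  have "\<exists>d\<in>D. Lp_pow M p (\<lambda>x. \<phi> x - d x) < e" if e: "0 < e" for e
  proof -
    define e' where "e' = e / (2 * 2 powr p)"
    have e': "0 < e'" "2 powr p * (e' + e') = e" using e by (auto simp: e'_def)
    obtain \<psi> where \<psi>: "\<psi> \<in> Lp_closure M p D" "Lp_pow M p (\<lambda>x. \<phi> x - \<psi> x) < e'"
      using approx[OF e'(1)] by blast
    obtain d where d: "d \<in> D" "Lp_pow M p (\<lambda>x. \<psi> x - d x) < e'"
      using \<psi>(1) e'(1) by (auto simp: Lp_closure_def)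
    have "Lp_pow M p (\<lambda>x. \<phi> x - d x)
        \<le> 2 powr p * (Lp_pow M p (\<lambda>x. \<phi> x - \<psi> x) + Lp_pow M p (\<lambda>x. \<psi> x - d x))"
      using p \<phi> \<psi>(1) d(1) D by (intro Lp_pow_triangle) (auto simp: Lp_closure_def)
    also have "\<dots> < 2 powr p * (e' + e')"
      using \<psi>(2) d(2) by (intro mult_strict_left_mono add_strict_mono) auto
    finally show ?thesis using e'(2) d(1) by auto
  qed
  then show ?thesis using \<phi> by (simp add: Lp_closure_def)
qed

lemma Lp_closure_limit:
  assumes p: "0 < p" and D: "D \<subseteq> Lp_funs M p" and \<phi>: "\<phi> \<in> Lp_funs M p"
    and s: "\<And>n. s n \<in> Lp_closure M p D" "\<And>x. (\<lambda>n. s n x) \<longlonglongrightarrow> \<phi> x"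
      "\<And>n x. norm (s n x) \<le> 2 * norm (\<phi> x)"
  shows "\<phi> \<in> Lp_closure M p D"
proof (rule Lp_closure_closed[OF p D \<phi>])
  fix e :: real assume e: "0 < e"
  have "(\<lambda>n. Lp_pow M p (\<lambda>x. \<phi> x - s n x)) \<longlonglongrightarrow> 0"
    using s(1) by (intro Lp_pow_dominated_convergence[OF \<phi> _ p s(2,3)])
      (auto simp: Lp_closure_def Lp_funs_def)
  then have "eventually (\<lambda>n. Lp_pow M p (\<lambda>x. \<phi> x - s n x) < e) sequentially"
    using e by (rule order_tendstoD)
  then show "\<exists>\<psi>\<in>Lp_closure M p D. Lp_pow M p (\<lambda>x. \<phi> x - \<psi> x) < e"
    using s(1) by (auto simp: eventually_sequentially)
qed

lemma Lp_closure_add: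
  assumes p: "0 < p" and D: "D \<subseteq> Lp_funs M p"
    and add: "\<And>d d'. d \<in> D \<Longrightarrow> d' \<in> D \<Longrightarrow> (\<lambda>x. d x + d' x) \<in> D"
    and \<phi>: "\<phi> \<in> Lp_closure M p D" and \<psi>: "\<psi> \<in> Lp_closure M p D"
  shows "(\<lambda>x. \<phi> x + \<psi> x) \<in> Lp_closure M p D"
proof -
  have "\<exists>d\<in>D. Lp_pow M p (\<lambda>x. \<phi> x + \<psi> x - d x) < e" if e: "0 < e" for e
  proof -
    define e' where "e' = e / (2 * 2 powr p)"
    have e': "0 < e'" "2 powr p * (e' + e') = e" using e by (auto simp: e'_def)
    obtain d where d: "d \<in> D" "Lp_pow M p (\<lambda>x. \<phi> x - d x) < e'"
      using \<phi> e'(1) by (auto simp: Lp_closure_def)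
    obtain d' where d': "d' \<in> D" "Lp_pow M p (\<lambda>x. \<psi> x - d' x) < e'"
      using \<psi> e'(1) by (auto simp: Lp_closure_def)
    have "Lp_pow M p (\<lambda>x. (\<phi> x - d x) + (\<psi> x - d' x))
        \<le> 2 powr p * (Lp_pow M p (\<lambda>x. \<phi> x - d x) + Lp_pow M p (\<lambda>x. \<psi> x - d' x))"
      using p \<phi> \<psi> d(1) d'(1) D by (intro Lp_funs_add Lp_funs_diff) (auto simp: Lp_closure_def)
    also have "\<dots> < 2 powr p * (e' + e')"
      using d(2) d'(2) by (intro mult_strict_left_mono add_strict_mono) auto
    finally show ?thesis
      using e'(2) by (intro bexI[OF _ add[OF d(1) d'(1)]]) (simp add: algebra_simps)
  qed
  then show ?thesis
    using p \<phi> \<psi> by (auto simp: Lp_closure_def intro!: Lp_funs_add(1))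
qed

abbreviation complex_rat :: "rat \<Rightarrow> rat \<Rightarrow> complex" where
  "complex_rat a b \<equiv> Complex (of_rat a) (of_rat b)"

lemma complex_rat_dense:
  assumes "0 < e"
  obtains a b where "norm (c - complex_rat a b) < e"
proof -
  obtain a b where a: "Re c < of_rat a" "of_rat a < Re c + e / 2"
    and b: "Im c < of_rat b" "of_rat b < Im c + e / 2"
    using of_rat_dense[of "Re c" "Re c + e / 2"] of_rat_dense[of "Im c" "Im c + e / 2"] assms by auto
  have "norm (c - complex_rat a b) \<le> \<bar>Re c - of_rat a\<bar> + \<bar>Im c - of_rat b\<bar>"
    using cmod_le[of "c - complex_rat a b"] by simp
  then show thesis using a b by (intro that[of a b]) linarith
qed

lemma Lp_closure_scale:
  assumes p: "0 < p" and D: "D \<subseteq> Lp_funs M p"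
    and scale: "\<And>d a b. d \<in> D \<Longrightarrow> (\<lambda>x. complex_rat a b * d x) \<in> D"
    and \<phi>: "\<phi> \<in> Lp_closure M p D"
  shows "(\<lambda>x. c * \<phi> x) \<in> Lp_closure M p D"
proof (rule Lp_closure_closed[OF p D])
  have \<phi>_Lp: "\<phi> \<in> Lp_funs M p" using \<phi> by (simp add: Lp_closure_def)
  then show "(\<lambda>x. c * \<phi> x) \<in> Lp_funs M p" by (rule Lp_funs_cmult)
  fix e :: real assume e: "0 < e"
  define \<eta> where "\<eta> = (e / (Lp_pow M p \<phi> + 1)) powr (1 / p)"
  have I: "0 \<le> Lp_pow M p \<phi>" by (rule Lp_pow_nonneg)
  then have \<eta>: "0 < \<eta>" "\<eta> powr p = e / (Lp_pow M p \<phi> + 1)"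
    using e p by (auto simp: \<eta>_def powr_powr)
  obtain a b where ab: "norm (c - complex_rat a b) < \<eta>"
    using complex_rat_dense[OF \<eta>(1)] by blast
  let ?r = "complex_rat a b"
  have "Lp_pow M p (\<lambda>x. c * \<phi> x - ?r * \<phi> x) = norm (c - ?r) powr p * Lp_pow M p \<phi>"
    by (simp add: Lp_pow_cmult[symmetric] left_diff_distrib)
  also have "\<dots> \<le> \<eta> powr p * Lp_pow M p \<phi>"
    using ab p I by (intro mult_right_mono powr_mono2) auto
  also have "\<dots> < e" using e I by (simp add: \<eta>(2) field_simps)
  finally have close: "Lp_pow M p (\<lambda>x. c * \<phi> x - ?r * \<phi> x) < e" .
  have "\<exists>d\<in>D. Lp_pow M p (\<lambda>x. ?r * \<phi> x - d x) < e'" if e': "0 < e'" for e'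
  proof -
    let ?k = "norm ?r powr p"
    obtain d where d: "d \<in> D" "Lp_pow M p (\<lambda>x. \<phi> x - d x) < e' / (?k + 1)"
      using \<phi> e' by (auto simp: Lp_closure_def add_nonneg_pos elim!: allE[of _ "e' / (?k + 1)"])
    have "Lp_pow M p (\<lambda>x. ?r * \<phi> x - ?r * d x) = ?k * Lp_pow M p (\<lambda>x. \<phi> x - d x)"
      by (simp only: Lp_pow_cmult[symmetric] right_diff_distrib)
    also have "\<dots> \<le> ?k * (e' / (?k + 1))"
      using d(2) by (intro mult_left_mono) auto
    also have "\<dots> < e'" using e' by (simp add: divide_less_eq add_pos_nonneg not_less)
    finally show ?thesis by (rule bexI[OF _ scale[OF d(1)]])
  qed
  then have "(\<lambda>x. ?r * \<phi> x) \<in> Lp_closure M p D"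
    using Lp_funs_cmult[OF \<phi>_Lp] by (simp add: Lp_closure_def)
  then show "\<exists>\<psi>\<in>Lp_closure M p D. Lp_pow M p (\<lambda>x. c * \<phi> x - \<psi> x) < e"
    by (rule bexI[where P = "\<lambda>\<psi>. Lp_pow M p (\<lambda>x. c * \<phi> x - \<psi> x) < e", OF close])
qed

context dissipative_system
begin

definition levels_upto :: "nat \<Rightarrow> 'a set" where
  "levels_upto q = (\<Union>i\<in>{- int q..int q}. level i)"

lemma levels_upto_sets [measurable]: "levels_upto q \<in> sets M"
  unfolding levels_upto_def by measurable

lemma emeasure_levels_upto_finite: "emeasure M (levels_upto q) < \<infinity>"
proof -
  have "emeasure M (levels_upto q) \<le> (\<Sum>i\<in>{- int q..int q}. emeasure M (level i))"
    unfolding levels_upto_def by (rule emeasure_subadditive_finite) auto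
  also have "\<dots> < \<infinity>" by (simp add: emeasure_level sum_ennreal level_mass_pos less_imp_le)
  finally show ?thesis .
qed

lemma indicator_levels_upto_Lp_funs:
  assumes "A \<in> sets M"
  shows "(indicator (A \<inter> levels_upto q) :: 'a \<Rightarrow> complex) \<in> Lp_funs M p"
proof -
  have "emeasure M (A \<inter> levels_upto q) < \<infinity>"
    using emeasure_mono[of "A \<inter> levels_upto q" "levels_upto q" M] emeasure_levels_upto_finite[of q]
    by (auto intro: le_less_trans)
  moreover have "(\<lambda>x. norm (indicator (A \<inter> levels_upto q) x :: complex) powr p) = indicator (A \<inter> levels_upto q)"
    by (auto simp: indicator_def fun_eq_iff)
  ultimately show ?thesis using assms by (simp add: Lp_funs_def integrable_indicator_iff)
qed

lemma borel_space_UNIV: "A \<in> sets M \<longleftrightarrow> A \<in> sigma_sets UNIV {S. open S}"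
  by (simp add: sets_eq_borel borel_def)

fun rational_step :: "(nat \<Rightarrow> 'a set) \<Rightarrow> (nat list \<times> nat \<times> rat \<times> rat) list \<Rightarrow> 'a \<Rightarrow> complex" where
  "rational_step Bs [] x = 0"
| "rational_step Bs ((is, q, a, b) # L) x =
    complex_rat a b * indicator ((\<Union>i\<in>set is. Bs i) \<inter> levels_upto q) x + rational_step Bs L x"

lemma rational_step_append: "rational_step Bs (L @ L') x = rational_step Bs L x + rational_step Bs L' x"
  by (induction L) auto

lemma rational_step_scale:
  "complex_rat a b * rational_step Bs L x
    = rational_step Bs (map (\<lambda>(is, q, c, d). (is, q, a * c - b * d, a * d + b * c)) L) x"
proof (induction L)
  case (Cons t L)
  obtain "is" q c d where t: "t = (is, q, c, d)" by (cases t)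
  have "complex_rat a b * complex_rat c d = complex_rat (a * c - b * d) (a * d + b * c)"
    by (simp add: complex_eq_iff of_rat_mult of_rat_diff of_rat_add)
  then show ?case by (simp add: t distrib_left Cons mult.assoc[symmetric] del: complex_mult)
qed simp

lemma rational_step_bounded: "\<exists>b. \<forall>x. norm (rational_step Bs L x) \<le> b"
proof (induction L)
  case (Cons t L)
  obtain "is" q c d where t: "t = (is, q, c, d)" by (cases t)
  obtain b where b: "\<And>x. norm (rational_step Bs L x) \<le> b" using Cons by blast
  have "norm (rational_step Bs (t # L) x) \<le> norm (complex_rat c d) + b" for x
  proof -
    let ?s = "complex_rat c d * indicator ((\<Union>i\<in>set is. Bs i) \<inter> levels_upto q) x"
    have "norm ?s \<le> norm (complex_rat c d)"
      by (cases "x \<in> (\<Union>i\<in>set is. Bs i) \<inter> levels_upto q") auto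
    then show ?thesis
      using norm_triangle_ineq[of ?s "rational_step Bs L x"] b[of x] by (simp add: t)
  qed
  then show ?case by blast
qed auto

lemma levels_upto_mono: "q \<le> r \<Longrightarrow> levels_upto q \<subseteq> levels_upto r"
  unfolding levels_upto_def by (intro UN_mono) auto

lemma rational_step_support: "\<exists>q. \<forall>x. rational_step Bs L x \<noteq> 0 \<longrightarrow> x \<in> levels_upto q"
proof (induction L)
  case (Cons t L)
  obtain "is" r c d where t: "t = (is, r, c, d)" by (cases t)
  obtain q where q: "\<And>x. rational_step Bs L x \<noteq> 0 \<Longrightarrow> x \<in> levels_upto q" using Cons by blast
  have "x \<in> levels_upto (max q r)" if "rational_step Bs (t # L) x \<noteq> 0" for x
  proof -
    have "x \<in> levels_upto r \<or> x \<in> levels_upto q"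
      using that q[of x] by (cases "x \<in> levels_upto r") (auto simp: t)
    then show ?thesis using levels_upto_mono[of q "max q r"] levels_upto_mono[of r "max q r"] by auto
  qed
  then show ?case by blast
qed auto

lemma rational_step_Lp_funs:
  assumes "\<And>i. Bs i \<in> sets M" "0 \<le> p"
  shows "rational_step Bs L \<in> Lp_funs M p"
proof (induction L)
  case Nil
  then show ?case by (simp add: Lp_funs_def)
next
  case (Cons t L)
  obtain "is" q c d where t: "t = (is, q, c, d)" by (cases t)
  have "(\<Union>i\<in>set is. Bs i) \<in> sets M" using assms(1) by auto
  then show ?case
    using Lp_funs_add(1)[OF assms(2) Lp_funs_cmult[OF indicator_levels_upto_Lp_funs] Cons] by (simp add: t)
qed

lemma rational_step_dense:
  assumes p: "0 < p" and Bs: "\<And>i. open (Bs i)"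
    and basis: "\<And>U. open U \<Longrightarrow> \<exists>J. U = (\<Union>i\<in>J. Bs i)"
  shows "Lp_closure M p (range (rational_step Bs)) = Lp_funs M p"
proof -
  let ?D = "range (rational_step Bs)" and ?H = "Lp_closure M p (range (rational_step Bs))"
  have open_sets: "S \<in> sets M" if "open S" for S
    using that by (simp add: sets_eq_borel)
  have D: "?D \<subseteq> Lp_funs M p" using p by (auto intro!: rational_step_Lp_funs open_sets Bs)
  have add: "(\<lambda>x. \<phi> x + \<psi> x) \<in> ?H" if "\<phi> \<in> ?H" "\<psi> \<in> ?H" for \<phi> \<psi>
    by (rule Lp_closure_add[OF p D _ that]) (auto simp: rational_step_append[symmetric])
  have scale: "(\<lambda>x. c * \<phi> x) \<in> ?H" if "\<phi> \<in> ?H" for \<phi> c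
    by (rule Lp_closure_scale[OF p D _ that]) (auto simp: rational_step_scale)
  have zero: "(\<lambda>x. 0) \<in> ?H"
  proof (rule Lp_closure_superset[OF D])
    have "rational_step Bs [] = (\<lambda>x. 0)" by auto
    then show "(\<lambda>x. 0) \<in> ?D" by (metis rangeI)
  qed
  have union_H: "(indicator ((\<Union>i. A i) \<inter> levels_upto q) :: 'a \<Rightarrow> complex) \<in> ?H"
    if "\<And>i. A i \<in> sets M" "\<And>n. (indicator ((\<Union>i<n. A i) \<inter> levels_upto q) :: 'a \<Rightarrow> complex) \<in> ?H"
    for A :: "nat \<Rightarrow> 'a set" and q
  proof (rule Lp_closure_limit[OF p D _ that(2)])
    show "(indicator ((\<Union>i. A i) \<inter> levels_upto q) :: 'a \<Rightarrow> complex) \<in> Lp_funs M p"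
      by (rule indicator_levels_upto_Lp_funs) (use that(1) in auto)
    show "(\<lambda>n. indicator ((\<Union>i<n. A i) \<inter> levels_upto q) x :: complex)
        \<longlonglongrightarrow> indicator ((\<Union>i. A i) \<inter> levels_upto q) x" for x
      unfolding indicator_inter_arith by (intro tendsto_intros LIMSEQ_indicator_UN)
    show "norm (indicator ((\<Union>i<n. A i) \<inter> levels_upto q) x :: complex)
        \<le> 2 * norm (indicator ((\<Union>i. A i) \<inter> levels_upto q) x :: complex)" for n x
      by (auto simp: indicator_def)
  qed
  have open_H: "(indicator (U \<inter> levels_upto q) :: 'a \<Rightarrow> complex) \<in> ?H" if U: "open U" for U q
  proof -
    obtain J where J: "U = (\<Union>i\<in>J. Bs i)" using basis[OF U] by blast
    define A where "A i = (if i \<in> J then Bs i else {})" for i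
    have "(indicator ((\<Union>i. A i) \<inter> levels_upto q) :: 'a \<Rightarrow> complex) \<in> ?H"
    proof (rule union_H)
      show "A i \<in> sets M" for i by (simp add: A_def open_sets Bs)
      fix n
      have "(\<Union>i<n. A i) = (\<Union>i\<in>set (filter (\<lambda>i. i \<in> J) [0..<n]). Bs i)"
        by (auto simp: A_def split: if_splits)
      then have "indicator ((\<Union>i<n. A i) \<inter> levels_upto q)
          = rational_step Bs [(filter (\<lambda>i. i \<in> J) [0..<n], q, 1, 0)]"
        by (simp add: fun_eq_iff complex_eq_iff indicator_def)
      then show "(indicator ((\<Union>i<n. A i) \<inter> levels_upto q) :: 'a \<Rightarrow> complex) \<in> ?H"
        using Lp_closure_superset[OF D] by simp
    qed
    moreover have "(\<Union>i. A i) = U" by (auto simp: A_def J split: if_splits)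
    ultimately show ?thesis by simp
  qed
  have sets: "(indicator (A \<inter> levels_upto q) :: 'a \<Rightarrow> complex) \<in> ?H" if "A \<in> sets M" for A q
  proof -
    have "Int_stable {S :: 'a set. open S}" by (auto simp: Int_stable_def)
    moreover have "{S :: 'a set. open S} \<subseteq> Pow UNIV" by simp
    ultimately show ?thesis using that[unfolded borel_space_UNIV]
    proof (induction A rule: sigma_sets_induct_disjoint)
      case (basic A)
      then show ?case using open_H by simp
    next
      case empty
      then show ?case using zero by (simp add: indicator_def[abs_def])
    next
      case (compl A)
      have "(\<lambda>x. indicator (UNIV \<inter> levels_upto q) x + (- 1) * indicator (A \<inter> levels_upto q) x :: complex) \<in> ?H"
        by (intro add scale compl open_H) simp
      moreover have "(\<lambda>x. indicator (UNIV \<inter> levels_upto q) x + (- 1) * indicator (A \<inter> levels_upto q) x :: complex)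
          = indicator ((UNIV - A) \<inter> levels_upto q)"
        by (auto simp: indicator_def)
      ultimately show ?case by simp
    next
      case (union A)
      have sets_A: "A i \<in> sets M" for i using union(2) by (auto simp: borel_space_UNIV)
      show ?case
      proof (rule union_H[OF sets_A])
        fix n show "(indicator ((\<Union>i<n. A i) \<inter> levels_upto q) :: 'a \<Rightarrow> complex) \<in> ?H"
        proof (induction n)
          case 0
          then show ?case using zero by (simp add: indicator_def[abs_def])
        next
          case (Suc n)
          have "A i \<inter> A n = {}" if "i < n" for i
            using union(1) that by (auto simp: disjoint_family_on_def)
          then have "indicator ((\<Union>i<Suc n. A i) \<inter> levels_upto q)
              = (\<lambda>x. indicator ((\<Union>i<n. A i) \<inter> levels_upto q) x + indicator (A n \<inter> levels_upto q) x :: complex)"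
            by (auto simp: fun_eq_iff indicator_def less_Suc_eq)
          then show ?case using add[OF Suc union(3)[of n]] by simp
        qed
      qed
    qed
  qed
  have sum: "(\<lambda>x. \<Sum>v\<in>V. g v x) \<in> ?H" if "finite V" "\<And>v. v \<in> V \<Longrightarrow> g v \<in> ?H"
    for V :: "complex set" and g
    using that by (induction V) (auto intro: zero add)
  have simple: "(\<lambda>x. s x * indicator (levels_upto q) x) \<in> ?H" if s: "simple_function M s" for s q
  proof -
    have "(\<lambda>x. \<Sum>v\<in>range s. v * indicator (s -` {v} \<inter> levels_upto q) x) \<in> ?H"
      using simple_functionD[OF s] by (intro sum scale sets) auto
    moreover have "(\<lambda>x. \<Sum>v\<in>range s. v * indicator (s -` {v} \<inter> levels_upto q) x)
        = (\<lambda>x. s x * indicator (levels_upto q) x)"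
    proof
      fix x
      have "(\<Sum>v\<in>range s. v * indicator (s -` {v} \<inter> levels_upto q) x)
          = (\<Sum>v\<in>range s. if v = s x then s x * indicator (levels_upto q) x else 0)"
        by (intro sum.cong) (auto simp: indicator_def)
      then show "(\<Sum>v\<in>range s. v * indicator (s -` {v} \<inter> levels_upto q) x) = s x * indicator (levels_upto q) x"
        using simple_functionD(1)[OF s] by simp
    qed
    ultimately show ?thesis by simp
  qed
  have "\<phi> \<in> ?H" if \<phi>: "\<phi> \<in> Lp_funs M p" for \<phi>
  proof -
    have "\<phi> \<in> borel_measurable M" using \<phi> by (simp add: Lp_funs_def)
    then obtain s where s: "\<And>n. simple_function M (s n)" "\<And>x. (\<lambda>n. s n x) \<longlonglongrightarrow> \<phi> x"
      "\<And>n x. norm (s n x) \<le> 2 * norm (\<phi> x)"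
      using borel_measurable_implies_sequence_metric[of \<phi> M 0] by auto
    show ?thesis
    proof (rule Lp_closure_limit[OF p D \<phi>])
      show "(\<lambda>x. s n x * indicator (levels_upto n) x) \<in> ?H" for n by (rule simple[OF s(1)])
      show "norm (s n x * indicator (levels_upto n) x) \<le> 2 * norm (\<phi> x)" for n x
        using s(3)[of n x] by (simp add: indicator_def)
      fix x
      obtain k where k: "x \<in> level k" using in_some_level by blast
      have "x \<in> levels_upto n" if "nat \<bar>k\<bar> \<le> n" for n
        using that k by (auto simp: levels_upto_def intro!: bexI[of _ k])
      then have "eventually (\<lambda>n. s n x = s n x * indicator (levels_upto n) x) sequentially"
        by (auto simp: eventually_sequentially intro!: exI[of _ "nat \<bar>k\<bar>"])
      then show "(\<lambda>n. s n x * indicator (levels_upto n) x) \<longlonglongrightarrow> \<phi> x"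
        by (rule Lim_transform_eventually[OF s(2)])
    qed
  qed
  then show ?thesis by (auto simp: Lp_closure_def)
qed

lemma dense_sequence:
  assumes p: "0 < p"
  obtains y :: "nat \<Rightarrow> 'a \<Rightarrow> complex"
  where "\<And>k. y k \<in> Lp_funs M p" "\<And>k. \<exists>b. \<forall>x. norm (y k x) \<le> b"
    "\<And>k. \<exists>q. \<forall>x. y k x \<noteq> 0 \<longrightarrow> x \<in> levels_upto q"
    "\<And>\<phi> e N. \<phi> \<in> Lp_funs M p \<Longrightarrow> 0 < e \<Longrightarrow> \<exists>k\<ge>N. Lp_pow M p (\<lambda>x. \<phi> x - y k x) < e"
proof -
  obtain \<B> :: "'a set set" where \<B>: "countable \<B>" "\<And>C. C \<in> \<B> \<Longrightarrow> open C"
    "\<And>S. open S \<Longrightarrow> \<exists>U. U \<subseteq> \<B> \<and> S = \<Union>U"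
    using univ_second_countable by blast
  define Bs where "Bs = from_nat_into (insert {} \<B>)"
  have range_Bs: "range Bs = insert {} \<B>"
    using \<B>(1) unfolding Bs_def by (intro range_from_nat_into) auto
  have Bs: "open (Bs i)" for i
    using range_Bs \<B>(2) by (metis insert_iff open_empty rangeI)
  have basis: "\<exists>J. U = (\<Union>i\<in>J. Bs i)" if U: "open U" for U
  proof -
    obtain V where V: "V \<subseteq> \<B>" "U = \<Union>V" using \<B>(3)[OF U] by blast
    then have "V = Bs ` (Bs -` V)" using range_Bs by (auto simp: image_vimage_eq)
    then have "U = (\<Union>i\<in>Bs -` V. Bs i)" using V(2) by metis
    then show ?thesis by blast
  qed
  define y where "y k = rational_step Bs (from_nat (fst (prod_decode k)))" for k
  show thesis
  proof (rule that[of y])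
    show "y k \<in> Lp_funs M p" for k
      unfolding y_def using p by (intro rational_step_Lp_funs) (auto simp: sets_eq_borel Bs)
    show "\<exists>b. \<forall>x. norm (y k x) \<le> b" for k unfolding y_def by (rule rational_step_bounded)
    show "\<exists>q. \<forall>x. y k x \<noteq> 0 \<longrightarrow> x \<in> levels_upto q" for k unfolding y_def by (rule rational_step_support)
    fix \<phi> and e :: real and N assume "\<phi> \<in> Lp_funs M p" "0 < e"
    then have "\<phi> \<in> Lp_closure M p (range (rational_step Bs))"
      using rational_step_dense[OF p Bs basis] by simp
    then obtain L where L: "Lp_pow M p (\<lambda>x. \<phi> x - rational_step Bs L x) < e"
      using \<open>0 < e\<close> by (auto simp: Lp_closure_def)
    show "\<exists>k\<ge>N. Lp_pow M p (\<lambda>x. \<phi> x - y k x) < e"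
    proof (intro exI conjI)
      show "N \<le> prod_encode (to_nat L, N)" by (rule le_prod_encode_2)
      show "Lp_pow M p (\<lambda>x. \<phi> x - y (prod_encode (to_nat L, N)) x) < e"
        using L by (simp add: y_def)
    qed
  qed
qed

end

subsection \<open>Construction of a supercyclic vector\<close>

lemma small_multiplier:
  fixes a b :: "'b \<Rightarrow> real"
  assumes "finite F" "\<And>j. j \<in> F \<Longrightarrow> 0 < b j"
  obtains \<delta> where "0 < \<delta>" "\<And>j. j \<in> F \<Longrightarrow> \<delta> * a j \<le> b j"
proof -
  have "\<forall>j\<in>F. eventually (\<lambda>\<delta>. \<delta> * a j < b j) (at_right 0)"
  proof
    fix j assume "j \<in> F"
    have "((\<lambda>\<delta>. \<delta> * a j) \<longlongrightarrow> 0 * a j) (at_right 0)" by (intro tendsto_intros)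
    then show "eventually (\<lambda>\<delta>. \<delta> * a j < b j) (at_right 0)"
      using assms(2)[OF \<open>j \<in> F\<close>] by (intro order_tendstoD) auto
  qed
  then have "eventually (\<lambda>\<delta>. \<forall>j\<in>F. \<delta> * a j < b j) (at_right 0)"
    by (rule eventually_ball_finite[OF assms(1)])
  then have "eventually (\<lambda>\<delta>. (\<forall>j\<in>F. \<delta> * a j < b j) \<and> 0 < \<delta>) (at_right 0)"
    by (intro eventually_conj) (auto intro: eventually_at_right_less)
  then obtain \<delta> where "\<forall>j\<in>F. \<delta> * a j < b j" "0 < \<delta>"
    using eventually_happens'[OF trivial_limit_at_right_real] by blast
  then show thesis by (intro that[of \<delta>]) (auto intro: less_imp_le)
qed

lemma sum_shift_le:
  fixes m :: "int \<Rightarrow> real"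
  assumes "\<And>k. 0 \<le> m k" "int q + \<bar>s\<bar> \<le> int Q"
  shows "(\<Sum>i\<in>{- int q..int q}. m (i + s)) \<le> (\<Sum>i\<in>{- int Q..int Q}. m i)"
proof -
  have "(\<Sum>i\<in>{- int q..int q}. m (i + s)) = (\<Sum>i\<in>(\<lambda>i. i + s) ` {- int q..int q}. m i)"
    by (subst sum.reindex) (auto simp: inj_on_def)
  also have "\<dots> \<le> (\<Sum>i\<in>{- int Q..int Q}. m i)"
    using assms by (intro sum_mono2) auto
  finally show ?thesis .
qed

text \<open>
  The old terms \<open>j < k\<close> require \<open>C'\<close> to be large, and the requirement that the new term does not
  disturb the old approximations forces \<open>C'\<close> to be small. With \<open>\<alpha>\<close> and \<open>\<beta>\<close> the masses of the levels
  near \<open>- n'\<close> and \<open>n'\<close>, the choice \<open>C' = \<alpha> / \<eta>\<close> meets both as soon as \<open>\<alpha> * \<beta>\<close> is small.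
\<close>

lemma blow_up_step:
  fixes m :: "int \<Rightarrow> real" and q :: "nat \<Rightarrow> nat" and A :: "nat \<Rightarrow> real" and E :: "nat \<Rightarrow> int \<Rightarrow> real"
    and n :: "nat \<Rightarrow> nat" and C :: "nat \<Rightarrow> real"
  assumes m: "\<And>i. 0 < m i" and A: "\<And>k. 0 \<le> A k"
    and E: "\<And>k n. E k n \<le> A k * (\<Sum>i\<in>{- int (q k)..int (q k)}. m (i - n))"
    and small: "\<And>N Q \<epsilon>. 0 < \<epsilon> \<Longrightarrow> \<exists>n::nat. N \<le> n \<and>
      (\<forall>i j. \<bar>i\<bar> \<le> int Q \<longrightarrow> \<bar>j\<bar> \<le> int Q \<longrightarrow> m (i - int n) * m (j + int n) < \<epsilon>)"
    and C: "\<And>j. j < k \<Longrightarrow> 0 < C j"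
  obtains n' :: nat and C' :: real where "0 < C'"
    "\<And>j. j < k \<Longrightarrow> n j + q j + q k < n'"
    "\<And>j. j < k \<Longrightarrow> C j * E j (int n' - int (n j)) \<le> C' * (1 / 2) ^ (j + k)"
    "\<And>j. j < k \<Longrightarrow> C' * E k (int (n j) - int n') \<le> C j * (1 / 2) ^ (k + j)"
proof -
  define Q where "Q = q k + (\<Sum>j<k. n j + q j)"
  have Q: "n j + q j + q k \<le> Q" if "j < k" for j
  proof -
    have "n j + q j \<le> (\<Sum>j<k. n j + q j)" using that by (intro member_le_sum) auto
    then show ?thesis by (simp add: Q_def)
  qed
  obtain \<eta> :: real where \<eta>: "0 < \<eta>" "\<And>j. j < k \<Longrightarrow> \<eta> * (C j * A j) \<le> (1 / 2) ^ (j + k)"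
    using small_multiplier[of "{..<k}" "\<lambda>j. (1 / 2) ^ (j + k)" "\<lambda>j. C j * A j"] by auto
  obtain \<delta> :: real where \<delta>: "0 < \<delta>" "\<And>j. j < k \<Longrightarrow> \<delta> * A k \<le> \<eta> * (C j * (1 / 2) ^ (k + j))"
    using small_multiplier[of "{..<k}" "\<lambda>j. \<eta> * (C j * (1 / 2) ^ (k + j))" "\<lambda>j. A k"] C \<eta>(1) by auto
  let ?I = "{- int Q..int Q}"
  define \<epsilon> where "\<epsilon> = \<delta> / (real (card ?I) * real (card ?I))"
  have "0 < card ?I" by (simp add: card_gt_0_iff)
  then have \<epsilon>: "0 < \<epsilon>" "real (card ?I) * (real (card ?I) * \<epsilon>) = \<delta>" using \<delta>(1) by (simp_all add: \<epsilon>_def)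
  obtain n' :: nat where n': "Q + 1 \<le> n'"
    and prod: "\<And>i j. \<bar>i\<bar> \<le> int Q \<Longrightarrow> \<bar>j\<bar> \<le> int Q \<Longrightarrow> m (i - int n') * m (j + int n') < \<epsilon>"
    using small[OF \<epsilon>(1)] by blast
  define \<alpha> \<beta> where "\<alpha> = (\<Sum>i\<in>?I. m (i - int n'))" and "\<beta> = (\<Sum>i\<in>?I. m (i + int n'))"
  have \<alpha>: "0 < \<alpha>" unfolding \<alpha>_def using m by (intro sum_pos) auto
  have \<alpha>\<beta>: "\<alpha> * \<beta> \<le> \<delta>"
  proof -
    have "\<alpha> * \<beta> = (\<Sum>i\<in>?I. \<Sum>j\<in>?I. m (i - int n') * m (j + int n'))"
      unfolding \<alpha>_def \<beta>_def by (rule sum_product)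
    also have "\<dots> \<le> (\<Sum>i\<in>?I. \<Sum>j\<in>?I. \<epsilon>)"
      by (intro sum_mono less_imp_le[OF prod]) auto
    finally show ?thesis using \<epsilon>(2) by simp
  qed
  show thesis
  proof (rule that[of "\<alpha> / \<eta>" n'])
    show "0 < \<alpha> / \<eta>" using \<alpha> \<eta>(1) by simp
    fix j assume j: "j < k"
    show "n j + q j + q k < n'" using Q[OF j] n' by linarith
    have "E j (int n' - int (n j)) \<le> A j * (\<Sum>i\<in>{- int (q j)..int (q j)}. m (i + int (n j) - int n'))"
      using E[of j "int n' - int (n j)"] by (simp add: algebra_simps)
    also have "\<dots> \<le> A j * \<alpha>"
      unfolding \<alpha>_def using Q[OF j] m
      by (intro mult_left_mono A sum_shift_le[of "\<lambda>i. m (i - int n')"]) (auto intro: less_imp_le)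
    finally have "C j * E j (int n' - int (n j)) \<le> C j * (A j * \<alpha>)"
      using C[OF j] by (intro mult_left_mono) auto
    also have "\<dots> = (\<alpha> / \<eta>) * (\<eta> * (C j * A j))" using \<eta>(1) by simp
    also have "\<dots> \<le> (\<alpha> / \<eta>) * (1 / 2) ^ (j + k)"
      using \<alpha> \<eta> j by (intro mult_left_mono) auto
    finally show "C j * E j (int n' - int (n j)) \<le> \<alpha> / \<eta> * (1 / 2) ^ (j + k)" .
    have "E k (int (n j) - int n') \<le> A k * (\<Sum>i\<in>{- int (q k)..int (q k)}. m (i + - int (n j) + int n'))"
      using E[of k "int (n j) - int n'"] by (simp add: algebra_simps)
    also have "\<dots> \<le> A k * \<beta>"
      unfolding \<beta>_def using Q[OF j] m
      by (intro mult_left_mono A sum_shift_le[of "\<lambda>i. m (i + int n')"]) (auto intro: less_imp_le)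
    finally have "\<alpha> / \<eta> * E k (int (n j) - int n') \<le> \<alpha> / \<eta> * (A k * \<beta>)"
      using \<alpha> \<eta>(1) by (intro mult_left_mono) auto
    also have "\<dots> = (\<alpha> * \<beta>) * A k / \<eta>" by simp
    also have "\<dots> \<le> \<delta> * A k / \<eta>"
      using \<eta>(1) by (intro divide_right_mono mult_right_mono \<alpha>\<beta> A) auto
    also have "\<dots> \<le> \<eta> * (C j * (1 / 2) ^ (k + j)) / \<eta>"
      using \<eta>(1) by (intro divide_right_mono \<delta>(2) j) auto
    finally show "\<alpha> / \<eta> * E k (int (n j) - int n') \<le> C j * (1 / 2) ^ (k + j)" using \<eta>(1) by simp
  qed
qed

lemma blow_up_sequence:
  fixes m :: "int \<Rightarrow> real" and q :: "nat \<Rightarrow> nat" and A :: "nat \<Rightarrow> real" and E :: "nat \<Rightarrow> int \<Rightarrow> real"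
  assumes m: "\<And>i. 0 < m i" and A: "\<And>k. 0 \<le> A k"
    and E: "\<And>k n. E k n \<le> A k * (\<Sum>i\<in>{- int (q k)..int (q k)}. m (i - n))"
    and small: "\<And>N Q \<epsilon>. 0 < \<epsilon> \<Longrightarrow> \<exists>n::nat. N \<le> n \<and>
      (\<forall>i j. \<bar>i\<bar> \<le> int Q \<longrightarrow> \<bar>j\<bar> \<le> int Q \<longrightarrow> m (i - int n) * m (j + int n) < \<epsilon>)"
  obtains n :: "nat \<Rightarrow> nat" and C :: "nat \<Rightarrow> real" where "n 0 = 0" "\<And>k. 0 < C k"
    "\<And>j k. j < k \<Longrightarrow> n j + q j + q k < n k"
    "\<And>j k. j \<noteq> k \<Longrightarrow> C j * E j (int (n k) - int (n j)) \<le> C k * (1 / 2) ^ (j + k)"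
proof -
  define P where "P h k r \<longleftrightarrow> (0 < snd r \<and> (k = 0 \<longrightarrow> fst r = 0) \<and> (\<forall>j<k.
      fst (h j) + q j + q k < fst r \<and>
      snd (h j) * E j (int (fst r) - int (fst (h j))) \<le> snd r * (1 / 2) ^ (j + k) \<and>
      snd r * E k (int (fst (h j)) - int (fst r)) \<le> snd (h j) * (1 / 2) ^ (k + j)))"
    for h :: "nat \<Rightarrow> nat \<times> real" and k r
  have "\<exists>h. \<forall>k. P h k (h k)"
  proof (rule dependent_wellorder_choice)
    show "P h k r = P g k r" if "\<And>j. j < k \<Longrightarrow> h j = g j" for r h g k
      using that by (auto simp: P_def)
    fix k h assume "\<And>j. j < k \<Longrightarrow> P h j (h j)"
    then have pos: "0 < snd (h j)" if "j < k" for j using that by (auto simp: P_def)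
    show "\<exists>r. P h k r"
    proof (cases "k = 0")
      case True
      then show ?thesis by (intro exI[of _ "(0, 1)"]) (simp add: P_def)
    next
      case False
      show ?thesis
      proof (rule blow_up_step[where m = m and A = A and E = E and q = q and k = k
            and C = "\<lambda>j. snd (h j)" and n = "\<lambda>j. fst (h j)", OF m A E small pos])
        fix n' :: nat and C' :: real
        assume "0 < C'" "\<And>j. j < k \<Longrightarrow> fst (h j) + q j + q k < n'"
          "\<And>j. j < k \<Longrightarrow> snd (h j) * E j (int n' - int (fst (h j))) \<le> C' * (1 / 2) ^ (j + k)"
          "\<And>j. j < k \<Longrightarrow> C' * E k (int (fst (h j)) - int n') \<le> snd (h j) * (1 / 2) ^ (k + j)"
        then show ?thesis using False by (intro exI[of _ "(n', C')"]) (simp add: P_def)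
      qed
    qed
  qed
  then obtain h where h: "\<And>k. P h k (h k)" by blast
  show thesis
  proof (rule that[of "\<lambda>k. fst (h k)" "\<lambda>k. snd (h k)"])
    show "fst (h 0) = 0" using h[of 0] by (simp add: P_def)
    show "0 < snd (h k)" for k using h[of k] by (simp add: P_def)
    show "fst (h j) + q j + q k < fst (h k)" if "j < k" for j k using h[of k] that by (simp add: P_def)
    fix j k :: nat assume "j \<noteq> k"
    then consider "j < k" | "k < j" by linarith
    then show "snd (h j) * E j (int (fst (h k)) - int (fst (h j))) \<le> snd (h k) * (1 / 2) ^ (j + k)"
      using h[of k] h[of j] by cases (simp_all add: P_def)
  qed
qed

context dissipative_system
begin

lemma bounded_comp_int_iterate:
  assumes [measurable]: "y \<in> borel_measurable M" and p: "0 < p"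
    and b: "\<And>x. norm (y x) \<le> b" and q: "\<And>x. y x \<noteq> 0 \<Longrightarrow> x \<in> levels_upto q"
  shows "(\<lambda>x. y (int_iterate f n x)) \<in> Lp_funs M p"
    and "Lp_pow M p (\<lambda>x. y (int_iterate f n x)) \<le> b powr p * (\<Sum>i\<in>{- int q..int q}. level_mass (i - n))"
proof -
  let ?g = "\<lambda>x. b powr p * (\<Sum>i\<in>{- int q..int q}. indicator (level (i - n)) x)"
  have int_level: "integrable M (indicator (level k) :: _ \<Rightarrow> real)" for k
    using emeasure_level_finite[of k] by (simp add: integrable_indicator_iff)
  have int_g: "integrable M ?g" using int_level by auto
  have le: "norm (y (int_iterate f n x)) powr p \<le> ?g x" for x
  proof (cases "y (int_iterate f n x) = 0")
    case False
    then obtain i where i: "i \<in> {- int q..int q}" "int_iterate f n x \<in> level i"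
      using q unfolding levels_upto_def by blast
    then have "(1::real) \<le> (\<Sum>i\<in>{- int q..int q}. indicator (level (i - n)) x)"
      using member_le_sum[of i "{- int q..int q}" "\<lambda>i. indicator (level (i - n)) x :: real"]
      by (simp add: mem_level_int_iterate)
    then have "b powr p * 1 \<le> ?g x" by (intro mult_left_mono) auto
    moreover have "norm (y (int_iterate f n x)) powr p \<le> b powr p"
      using b p by (intro powr_mono2) auto
    ultimately show ?thesis by simp
  qed (auto intro!: mult_nonneg_nonneg sum_nonneg)
  have int_y: "integrable M (\<lambda>x. norm (y (int_iterate f n x)) powr p)"
    by (rule Bochner_Integration.integrable_bound[OF int_g])
      (use le order_trans[OF le abs_ge_self] in auto)
  then show "(\<lambda>x. y (int_iterate f n x)) \<in> Lp_funs M p" by (simp add: Lp_funs_def)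
  have "Lp_pow M p (\<lambda>x. y (int_iterate f n x)) \<le> (\<integral>x. ?g x \<partial>M)"
    unfolding Lp_pow_def by (rule integral_mono[OF int_y int_g le])
  also have "\<dots> = b powr p * (\<Sum>i\<in>{- int q..int q}. level_mass (i - n))"
    using int_level by (simp add: level_mass_def)
  finally show "Lp_pow M p (\<lambda>x. y (int_iterate f n x))
    \<le> b powr p * (\<Sum>i\<in>{- int q..int q}. level_mass (i - n))" .
qed

lemma levels_upto_bound: "x \<in> level l \<Longrightarrow> int_iterate f a x \<in> levels_upto q \<Longrightarrow> \<bar>l + a\<bar> \<le> int q"
proof -
  assume x: "x \<in> level l" and "int_iterate f a x \<in> levels_upto q"
  then obtain i where i: "i \<in> {- int q..int q}" "x \<in> level (i - a)"
    unfolding levels_upto_def UN_iff mem_level_int_iterate by blast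
  then have "l = i - a" using level_unique[OF x] by blast
  then show ?thesis using i(1) by auto
qed

lemma supercyclic_composition_if_small_products:
  assumes p: "0 < p"
    and small: "\<And>N Q \<epsilon>. 0 < \<epsilon> \<Longrightarrow> \<exists>n::nat. N \<le> n \<and>
      (\<forall>i j. \<bar>i\<bar> \<le> int Q \<longrightarrow> \<bar>j\<bar> \<le> int Q \<longrightarrow> level_mass (i - int n) * level_mass (j + int n) < \<epsilon>)"
  shows "real_supercyclic (Lp_space M p) (Lp_dist M p) (Lp_scale M p) (composition_operator M p f)"
proof -
  obtain y :: "nat \<Rightarrow> 'a \<Rightarrow> complex" where y: "\<And>k. y k \<in> Lp_funs M p"
    and "\<And>k. \<exists>b. \<forall>x. norm (y k x) \<le> b" "\<And>k. \<exists>q. \<forall>x. y k x \<noteq> 0 \<longrightarrow> x \<in> levels_upto q"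
    and dense: "\<And>\<phi> e N. \<phi> \<in> Lp_funs M p \<Longrightarrow> 0 < e \<Longrightarrow> \<exists>k\<ge>N. Lp_pow M p (\<lambda>x. \<phi> x - y k x) < e"
    using dense_sequence[OF p] by blast
  then obtain b q where b: "\<And>k x. norm (y k x) \<le> b k"
    and q: "\<And>k x. y k x \<noteq> 0 \<Longrightarrow> x \<in> levels_upto (q k)" by metis
  have y_meas: "y k \<in> borel_measurable M" for k using y by (simp add: Lp_funs_def)
  define E where "E k a = Lp_pow M p (\<lambda>x. y k (int_iterate f a x))" for k a
  note y_iter = bounded_comp_int_iterate[OF y_meas p b q]
  have E0: "0 \<le> E k a" for k a by (simp add: E_def Lp_pow_nonneg)
  obtain n C where n0: "n 0 = (0::nat)" and C: "\<And>k. 0 < C k"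
    and gap: "\<And>j k. j < k \<Longrightarrow> n j + q j + q k < n k"
    and decay: "\<And>j k. j \<noteq> k \<Longrightarrow> C j * E j (int (n k) - int (n j)) \<le> C k * (1 / 2) ^ (j + k)"
  proof (rule blow_up_sequence[where m = level_mass and A = "\<lambda>k. b k powr p" and E = E and q = q,
        OF level_mass_pos _ _ small])
    show "E k a \<le> b k powr p * (\<Sum>i = - int (q k)..int (q k). level_mass (i - a))" for k a
      unfolding E_def by (rule y_iter(2))
  qed auto
  define c where "c k = C k powr (1 / p)" for k
  have c: "0 < c k" "c k powr p = C k" for k
    using C[of k] p by (simp_all add: c_def powr_powr)
  define w where "w a j x = of_real (c j) * y j (int_iterate f (a - int (n j)) x)" for a j x
  have w_Lp: "w a j \<in> Lp_funs M p" for a j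
    unfolding w_def by (intro Lp_funs_cmult y_iter(1))
  have w_pow: "Lp_pow M p (w a j) = C j * E j (a - int (n j))" for a j
    unfolding w_def Lp_pow_cmult E_def using c[of j] by simp
  have disj: "i = j" if "w a i x \<noteq> 0" "w a j x \<noteq> 0" for a i j x
  proof -
    obtain l where l: "x \<in> level l" using in_some_level by blast
    have near: "\<bar>l + (a - int (n k))\<bar> \<le> int (q k)" if "w a k x \<noteq> 0" for k
      using that by (intro levels_upto_bound[OF l] q) (auto simp: w_def)
    show ?thesis
      using gap[of i j] gap[of j i] near[OF that(1)] near[OF that(2)]
      by (cases i j rule: linorder_cases) auto
  qed
  define \<phi> where "\<phi> x = (\<Sum>j. w 0 j x)" for x
  have \<phi>: "\<phi> \<in> Lp_funs M p"
    unfolding \<phi>_def[abs_def]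
  proof (rule Lp_funs_suminf_disjoint(1))
    let ?K = "C 0 + C 0 * E 0 0"
    show "summable (\<lambda>j. ?K * (1 / 2) ^ j)" by (intro summable_mult summable_geometric) simp
    show "Lp_pow M p (w 0 j) \<le> ?K * (1 / 2) ^ j" for j
    proof (cases "j = 0")
      case False
      have "C j * E j (0 - int (n j)) \<le> C 0 * (1 / 2) ^ j" using decay[OF False] n0 by simp
      also have "\<dots> \<le> ?K * (1 / 2) ^ j" using C[of 0] E0[of 0 0] by (intro mult_right_mono) auto
      finally show ?thesis by (simp add: w_pow)
    qed (use C[of 0] n0 in \<open>simp add: w_pow\<close>)
  qed (use disj w_Lp in blast)+
  have orbit: "\<phi> ((f ^^ n k) x) = (\<Sum>j. w (int (n k)) j x)" for k x
    by (simp add: \<phi>_def w_def int_iterate_of_nat[symmetric] int_iterate_add[symmetric] algebra_simps)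
  have approx: "(\<lambda>x. of_real (1 / c k) * \<phi> ((f ^^ n k) x) - y k x) \<in> Lp_funs M p \<and>
      Lp_pow M p (\<lambda>x. of_real (1 / c k) * \<phi> ((f ^^ n k) x) - y k x) \<le> 2 * (1 / 2) ^ k" for k
  proof -
    define z where "z j x = (if j = k then 0 else of_real (1 / c k) * w (int (n k)) j x)" for j x
    have eq: "of_real (1 / c k) * \<phi> ((f ^^ n k) x) - y k x = (\<Sum>j. z j x)" for x
    proof -
      let ?w = "\<lambda>j. of_real (1 / c k) * w (int (n k)) j x"
      have sum_w: "summable (\<lambda>j. w (int (n k)) j x)"
        by (rule norm_powr_suminf_disjoint(1)) (rule disj)
      have "?w k = y k x" using c(1)[of k] by (simp add: w_def)
      then have split: "(\<lambda>j. z j x) = (\<lambda>j. ?w j - (if j = k then y k x else 0))"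
        by (auto simp: z_def)
      have "?w sums (of_real (1 / c k) * \<phi> ((f ^^ n k) x))"
        unfolding orbit using sum_w by (intro sums_mult summable_sums)
      from sums_diff[OF this sums_single[of k "\<lambda>j. y k x"]]
      have "(\<lambda>j. z j x) sums (of_real (1 / c k) * \<phi> ((f ^^ n k) x) - y k x)"
        unfolding split .
      then show ?thesis by (rule sums_unique)
    qed
    have sums: "(\<lambda>j. (1 / 2) ^ (j + k)) sums (2 * (1 / 2) ^ k :: real)"
      using sums_mult2[OF geometric_sums[of "1 / 2 :: real"], of "(1 / 2) ^ k"] by (simp add: power_add)
    have z_Lp: "z j \<in> Lp_funs M p" for j
    proof (cases "j = k")
      case True
      then have "z j = (\<lambda>x. 0)" by (simp add: z_def fun_eq_iff)
      then show ?thesis by (simp add: Lp_funs_def)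
    next
      case False
      then have "z j = (\<lambda>x. of_real (1 / c k) * w (int (n k)) j x)" by (simp add: z_def fun_eq_iff)
      then show ?thesis by (simp only: Lp_funs_cmult[OF w_Lp])
    qed
    have z_pow: "Lp_pow M p (z j) \<le> (1 / 2) ^ (j + k)" for j
    proof (cases "j = k")
      case False
      have "norm (complex_of_real (1 / c k)) powr p = 1 / C k"
        using c[of k] by (simp add: norm_divide powr_divide)
      then have "Lp_pow M p (z j) = C j * E j (int (n k) - int (n j)) / C k"
        using False by (simp add: z_def[abs_def] Lp_pow_cmult w_pow del: of_real_divide)
      also have "\<dots> \<le> (1 / 2) ^ (j + k)"
        using decay[OF False] C[of k] by (simp add: divide_le_eq mult.commute)
      finally show ?thesis .
    qed (simp add: z_def[abs_def] Lp_pow_def)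
    have z_disj: "i = j" if "z i x \<noteq> 0" "z j x \<noteq> 0" for i j x
      using that by (intro disj[of "int (n k)" i x j]) (auto simp: z_def split: if_splits)
    show ?thesis
      unfolding eq using Lp_funs_suminf_disjoint[OF z_disj z_Lp sums_summable[OF sums] z_pow] sums
      by (simp add: sums_iff)
  qed
  have "\<exists>l n. Lp_pow M p (\<lambda>x. of_real l * \<phi> ((f ^^ n) x) - \<psi> x) < e"
    if \<psi>: "\<psi> \<in> Lp_funs M p" and e: "0 < e" for \<psi> e
  proof -
    define e' where "e' = e / (2 * 2 powr p)"
    have e': "0 < e'" "2 powr p * (e' + e') = e" using e by (auto simp: e'_def)
    obtain N where N: "(1 / 2) ^ N < e' / 2"
      using real_arch_pow_inv[of "e' / 2" "1 / 2"] e' by auto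
    obtain k where k: "N \<le> k" "Lp_pow M p (\<lambda>x. \<psi> x - y k x) < e'"
      using dense[OF \<psi> e'(1)] by blast
    have "(1 / 2 :: real) ^ k \<le> (1 / 2) ^ N" using k(1) by (intro power_decreasing) auto
    then have close: "Lp_pow M p (\<lambda>x. of_real (1 / c k) * \<phi> ((f ^^ n k) x) - y k x) < e'"
      using approx[of k] N by linarith
    have orbit_Lp: "(\<lambda>x. of_real (1 / c k) * \<phi> ((f ^^ n k) x)) \<in> Lp_funs M p"
      using Lp_funs_cmult[OF comp_funpow_Lp_funs[OF \<phi>]] by (simp only: o_apply)
    have "Lp_pow M p (\<lambda>x. of_real (1 / c k) * \<phi> ((f ^^ n k) x) - \<psi> x)
        \<le> 2 powr p * (Lp_pow M p (\<lambda>x. of_real (1 / c k) * \<phi> ((f ^^ n k) x) - y k x)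
          + Lp_pow M p (\<lambda>x. y k x - \<psi> x))"
      using p by (intro Lp_pow_triangle orbit_Lp y \<psi>) simp
    also have "Lp_pow M p (\<lambda>x. y k x - \<psi> x) = Lp_pow M p (\<lambda>x. \<psi> x - y k x)"
      by (simp add: Lp_pow_def norm_minus_commute)
    also have "2 powr p * (Lp_pow M p (\<lambda>x. of_real (1 / c k) * \<phi> ((f ^^ n k) x) - y k x)
          + Lp_pow M p (\<lambda>x. \<psi> x - y k x)) < 2 powr p * (e' + e')"
      using close k(2) by (intro mult_strict_left_mono add_strict_mono) auto
    finally show ?thesis unfolding e'(2) by blast
  qed
  then show ?thesis
    unfolding real_supercyclic_Lp_iff[OF p] using \<phi> by blast
qed

lemma supercyclic_shift_imp_composition:
  assumes p: "0 < p"
    and "real_supercyclic (lp_space p) (lp_dist p) lp_scale (backward_shift (system_weights M f W p))"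
  shows "real_supercyclic (Lp_space M p) (Lp_dist M p) (Lp_scale M p) (composition_operator M p f)"
proof (rule supercyclic_composition_if_small_products[OF p])
  fix N Q :: nat and \<epsilon> :: real assume \<epsilon>: "0 < \<epsilon>"
  obtain x where x: "x \<in> lp_space p" and dense: "\<And>y e. y \<in> lp_space p \<Longrightarrow> 0 < e \<Longrightarrow>
      \<exists>l n. lp_pow p (\<lambda>i. of_real l * (backward_shift (\<lambda>k. level_weight p (k - 1) / level_weight p k) ^^ n) x i - y i) < e"
    using assms(2) unfolding real_supercyclic_lp_iff[OF p] system_weights_eq by blast
  obtain C where C: "\<And>k. level_weight p (k - 1) \<le> C * level_weight p k"
    using level_weight_pred_le[OF p] by blast
  have "0 < \<epsilon> powr (1 / p)" using \<epsilon> by simp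
  then obtain n where n: "N \<le> n" and prod: "\<And>i j. \<bar>i\<bar> \<le> int Q \<Longrightarrow> \<bar>j\<bar> \<le> int Q \<Longrightarrow>
      level_weight p (i - int n) * level_weight p (j + int n) < \<epsilon> powr (1 / p)"
    using supercyclic_backward_shift_imp[OF p level_weight_pos C x dense] by blast
  have "level_mass (i - int n) * level_mass (j + int n) < \<epsilon>" if "\<bar>i\<bar> \<le> int Q" "\<bar>j\<bar> \<le> int Q" for i j
  proof -
    have "(level_weight p (i - int n) * level_weight p (j + int n)) powr p < (\<epsilon> powr (1 / p)) powr p"
      using prod[OF that] p level_weight_pos[of p "i - int n"] level_weight_pos[of p "j + int n"]
      by (intro powr_less_mono2) auto
    then show ?thesis
      using p \<epsilon> by (simp add: powr_mult level_weight_powr powr_powr)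
  qed
  then show "\<exists>n\<ge>N. \<forall>i j. \<bar>i\<bar> \<le> int Q \<longrightarrow> \<bar>j\<bar> \<le> int Q \<longrightarrow>
      level_mass (i - int n) * level_mass (j + int n) < \<epsilon>"
    using n by blast
qed

end

theorem theorem4p5:
  fixes M :: "'a::{second_countable_topology, t2_space} measure"
    and f :: "'a \<Rightarrow> 'a"
    and W :: "'a set"
    and p :: real
  assumes "1 \<le> p"
    and "bounded_distortion_system M f W"
  shows "real_supercyclic (Lp_space M p) (Lp_dist M p) (Lp_scale M p) (composition_operator M p f)
    \<longleftrightarrow> real_supercyclic (lp_space p) (lp_dist p) lp_scale (backward_shift (system_weights M f W p))"
proof -
  interpret bounded_distortion_system M f W by fact
  show ?thesis
    using supercyclic_composition_imp_shift supercyclic_shift_imp_composition assms(1) by auto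
qed

end
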